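(* For integers $r\ge 1$ and $0\le k\le r$ define the symmetric function $$F(r,k)=\Big(s_{(3^{k-2},2^2)}+2\,s_{(3^{k-2},2,1)}+s_{(3^{k-1},1)}+s_{(3^{k-2},1^2)}+2\,s_{(3^{k-1})}+s_{(3^{k-2},2)}\Big)\, s_{(3^{r-k})}-\Big(s_{(3^{k-1},2)}+s_{(3^{k-1},1)}\Big)\Big(s_{(3^{r-k-1},2)}+s_{(3^{r-k-1},1)}\Big).$$ Then for every $r\ge1$ the symmetric function $\sum_{k=0}^{r}F(r,k)$ is Schur positive.
   Context: $s_\lambda$ denotes the Schur function (in infinitely many variables) indexed by the partition $\lambda$, and $s_\varnothing=1$. In a partition, $i^{m}$ means that the part $i$ is repeated $m$ times. Convention: $s_\lambda=0$ whenever $\lambda$ does not define a valid partition; in particular, any Schur function whose index contains $3^{m}$ with $m<0$ is $0$. A symmetric function $f$ is Schur positive if in its expansion $f=\sum_\lambda a_\lambda s_\lambda$ all coefficients $a_\lambda$ are nonnegative ($f$ need not be homogeneous). *)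

theory Defs
  imports Main "HOL-Library.Multiset" "HOL-Library.FuncSet"
begin

section \<open>Formal power series in infinitely many variables\<close>

text \<open>
  A formal power series in the variables \<open>x\<^sub>0, x\<^sub>1, x\<^sub>2, \<dots>\<close> is its family of coefficients.  The
  monomial \<open>x\<^sub>i x\<^sub>j x\<^sub>k \<dots>\<close> is represented by the multiset \<open>{#i, j, k, \<dots>#}\<close>, so that
  multiplication of monomials is addition of multisets.
\<close>

typedef 'a mfps = "UNIV :: (nat multiset \<Rightarrow> 'a) set"
  morphisms mcoeff Abs_mfps
  by simp

lemma mcoeff_Abs [simp]: "mcoeff (Abs_mfps f) = f"
  by (simp add: Abs_mfps_inverse)

lemma mfps_eqI: "(\<And>M. mcoeff f M = mcoeff g M) \<Longrightarrow> f = g"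
  by (metis ext mcoeff_inject)

lemma finite_multiset_splits: "finite {(A, B). A + B = (M :: 'b multiset)}"
proof (rule finite_subset)
  show "{(A, B). A + B = M} \<subseteq> (\<lambda>A. (A, M - A)) ` (mset ` {xs. set xs \<subseteq> set_mset M \<and> length xs \<le> size M})"
  proof clarify
    fix A B :: "'b multiset"
    assume M: "M = A + B"
    obtain xs where xs: "A = mset xs"
      by (metis ex_mset)
    have "xs \<in> {xs. set xs \<subseteq> set_mset (A + B) \<and> length xs \<le> size (A + B)}"
      by (auto simp: xs)
    then show "(A, B) \<in> (\<lambda>A'. (A', A + B - A')) `
        (mset ` {xs. set xs \<subseteq> set_mset (A + B) \<and> length xs \<le> size (A + B)})"
      using xs by (intro image_eqI[where x = A]) auto
  qed
  show "finite ((\<lambda>A. (A, M - A)) ` (mset ` {xs. set xs \<subseteq> set_mset M \<and> length xs \<le> size M}))"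
    by (intro finite_imageI finite_lists_length_le) simp
qed

instantiation mfps :: (comm_ring_1) comm_ring_1
begin

definition zero_mfps :: "'a mfps" where
  "0 = Abs_mfps (\<lambda>_. 0)"

definition one_mfps :: "'a mfps" where
  "1 = Abs_mfps (\<lambda>M. if M = {#} then 1 else 0)"

definition plus_mfps :: "'a mfps \<Rightarrow> 'a mfps \<Rightarrow> 'a mfps" where
  "f + g = Abs_mfps (\<lambda>M. mcoeff f M + mcoeff g M)"

definition minus_mfps :: "'a mfps \<Rightarrow> 'a mfps \<Rightarrow> 'a mfps" where
  "f - g = Abs_mfps (\<lambda>M. mcoeff f M - mcoeff g M)"

definition uminus_mfps :: "'a mfps \<Rightarrow> 'a mfps" where
  "- f = Abs_mfps (\<lambda>M. - mcoeff f M)"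

definition times_mfps :: "'a mfps \<Rightarrow> 'a mfps \<Rightarrow> 'a mfps" where
  "f * g = Abs_mfps (\<lambda>M. \<Sum>(A, B) | A + B = M. mcoeff f A * mcoeff g B)"

lemma mcoeff_simps:
  "mcoeff 0 M = (0::'a)"
  "mcoeff 1 M = (if M = {#} then 1 else 0 :: 'a)"
  "mcoeff (f + g) M = mcoeff f M + (mcoeff g M :: 'a)"
  "mcoeff (f - g) M = mcoeff f M - (mcoeff g M :: 'a)"
  "mcoeff (- f) M = - (mcoeff f M :: 'a)"
  by (simp_all add: zero_mfps_def one_mfps_def plus_mfps_def minus_mfps_def uminus_mfps_def)

lemma mcoeff_mult:
  "mcoeff (f * g) M = (\<Sum>(A, B) | A + B = M. mcoeff f A * mcoeff g B :: 'a)"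
  by (simp add: times_mfps_def)

instance
proof
  fix f g h :: "'a mfps"
  show "f * g * h = f * (g * h)"
  proof (rule mfps_eqI)
    fix M
    let ?S = "\<lambda>M :: nat multiset. {(A, B). A + B = M}"
    have "mcoeff (f * g * h) M =
        (\<Sum>p\<in>?S M. \<Sum>q\<in>?S (fst p). mcoeff f (fst q) * mcoeff g (snd q) * mcoeff h (snd p))"
      by (simp add: mcoeff_mult sum_distrib_right case_prod_unfold)
    also have "\<dots> = (\<Sum>(p, q)\<in>Sigma (?S M) (\<lambda>p. ?S (fst p)).
        mcoeff f (fst q) * mcoeff g (snd q) * mcoeff h (snd p))"
      by (subst sum.Sigma) (simp_all add: finite_multiset_splits)
    also have "\<dots> = (\<Sum>(p, q)\<in>Sigma (?S M) (\<lambda>p. ?S (snd p)).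
        mcoeff f (fst p) * (mcoeff g (fst q) * mcoeff h (snd q)))"
      by (rule sum.reindex_bij_witness[where
            i = "\<lambda>((A, B), (C, D)). ((A + C, D), (A, C))" and
            j = "\<lambda>((A, B), (C, D)). ((C, D + B), (D, B))"])
         (auto simp: ac_simps)
    also have "\<dots> = (\<Sum>p\<in>?S M. \<Sum>q\<in>?S (snd p).
        mcoeff f (fst p) * (mcoeff g (fst q) * mcoeff h (snd q)))"
      by (subst sum.Sigma) (simp_all add: finite_multiset_splits)
    also have "\<dots> = mcoeff (f * (g * h)) M"
      by (simp add: mcoeff_mult sum_distrib_left case_prod_unfold)
    finally show "mcoeff (f * g * h) M = mcoeff (f * (g * h)) M" .
  qed
  show "f * g = g * f"
  proof (rule mfps_eqI)
    fix M
    show "mcoeff (f * g) M = mcoeff (g * f) M"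
      unfolding mcoeff_mult
      by (rule sum.reindex_bij_witness[where i = prod.swap and j = prod.swap])
         (auto simp: ac_simps)
  qed
  show "1 * f = f"
  proof (rule mfps_eqI)
    fix M
    have "mcoeff (1 * f) M =
        (\<Sum>p | fst p + snd p = M. if p = ({#}, M) then mcoeff f M else 0)"
      unfolding mcoeff_mult case_prod_unfold
      by (rule sum.cong) (auto simp: mcoeff_simps)
    also have "\<dots> = mcoeff f M"
      using finite_multiset_splits[of M] by (simp add: case_prod_unfold)
    finally show "mcoeff (1 * f) M = mcoeff f M" .
  qed
  show "(f + g) * h = f * h + g * h"
    by (rule mfps_eqI)
       (simp add: mcoeff_mult mcoeff_simps case_prod_unfold distrib_right sum.distrib)
  show "f + g + h = f + (g + h)" "f + g = g + f" "0 + f = f" "- f + f = 0" "f - g = f + - g"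
    by (auto intro!: mfps_eqI simp: mcoeff_simps)
  have "mcoeff (0 :: 'a mfps) {#} \<noteq> mcoeff 1 {#}"
    by (simp add: mcoeff_simps)
  then show "(0 :: 'a mfps) \<noteq> 1"
    by metis
qed

end

section \<open>Schur functions\<close>

definition is_partition :: "nat list \<Rightarrow> bool" where
  "is_partition \<mu> \<longleftrightarrow> sorted_wrt (\<ge>) \<mu> \<and> 0 \<notin> set \<mu>"

definition cells :: "nat list \<Rightarrow> (nat \<times> nat) set" where
  "cells \<mu> = {(i, j). i < length \<mu> \<and> j < \<mu> ! i}"

text \<open>
  Semistandard Young tableaux (English notation).  Extensionality pins down the irrelevant values
  outside the diagram, so that distinct functions are distinct tableaux.
\<close>

definition ssyt :: "nat list \<Rightarrow> (nat \<times> nat \<Rightarrow> nat) set" where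
  "ssyt \<mu> = {T \<in> extensional (cells \<mu>).
     (\<forall>i j. (i, j) \<in> cells \<mu> \<and> (i, Suc j) \<in> cells \<mu> \<longrightarrow> T (i, j) \<le> T (i, Suc j)) \<and>
     (\<forall>i j. (i, j) \<in> cells \<mu> \<and> (Suc i, j) \<in> cells \<mu> \<longrightarrow> T (i, j) < T (Suc i, j))}"

definition content :: "nat list \<Rightarrow> (nat \<times> nat \<Rightarrow> nat) \<Rightarrow> nat multiset" where
  "content \<mu> T = image_mset T (mset_set (cells \<mu>))"

text \<open>
  \<open>s\<^sub>\<mu> = (\<Sum>T. \<Prod>c. x\<^bsub>T c\<^esub>)\<close>, with \<open>T\<close> ranging over the semistandard tableaux of shape \<open>\<mu>\<close>: the
  coefficient of a monomial counts the tableaux with that content.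
\<close>

definition schur :: "nat list \<Rightarrow> int mfps" where
  "schur \<mu> = (if is_partition \<mu>
     then Abs_mfps (\<lambda>M. int (card {T \<in> ssyt \<mu>. content \<mu> T = M})) else 0)"

text \<open>The cardinality above is that of a finite set, and \<open>s\<^sub>\<emptyset> = 1\<close>.\<close>

lemma finite_cells [simp]: "finite (cells \<mu>)"
proof (rule finite_subset)
  show "cells \<mu> \<subseteq> (SIGMA i:{..<length \<mu>}. {..<\<mu> ! i})"
    by (auto simp: cells_def)
qed simp

lemma finite_ssyt_content: "finite {T \<in> ssyt \<mu>. content \<mu> T = M}"
proof (rule finite_subset)
  show "{T \<in> ssyt \<mu>. content \<mu> T = M} \<subseteq> cells \<mu> \<rightarrow>\<^sub>E set_mset M"
    by (auto simp: ssyt_def content_def PiE_def)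
  show "finite (cells \<mu> \<rightarrow>\<^sub>E set_mset M)"
    by (intro finite_PiE) auto
qed

lemma schur_Nil: "schur [] = 1"
proof (rule mfps_eqI)
  fix M :: "nat multiset"
  have "{T \<in> ssyt []. content [] T = M} = (if M = {#} then {\<lambda>_. undefined} else {})"
    by (auto simp: ssyt_def content_def cells_def)
  then show "mcoeff (schur []) M = mcoeff 1 M"
    by (simp add: schur_def is_partition_def mcoeff_simps)
qed

text \<open>\<open>schur_rep i m \<mu>\<close> is the Schur function indexed by \<open>(i\<^sup>m, \<mu>)\<close>, which is 0 for negative \<open>m\<close>.\<close>

definition schur_rep :: "nat \<Rightarrow> int \<Rightarrow> nat list \<Rightarrow> int mfps" where
  "schur_rep i m \<mu> = (if m < 0 then 0 else schur (replicate (nat m) i @ \<mu>))"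

text \<open>
  The Schur functions are linearly independent, so the coefficient family \<open>a\<close> in the following
  definition is determined by \<open>f\<close>.
\<close>

definition schur_expansion :: "int mfps \<Rightarrow> (nat list \<Rightarrow> int) \<Rightarrow> bool" where
  "schur_expansion f a \<longleftrightarrow>
     finite {\<mu>. a \<mu> \<noteq> 0} \<and> (\<forall>\<mu>. a \<mu> \<noteq> 0 \<longrightarrow> is_partition \<mu>) \<and>
     f = (\<Sum>\<mu> | a \<mu> \<noteq> 0. of_int (a \<mu>) * schur \<mu>)"

definition schur_positive :: "int mfps \<Rightarrow> bool" where
  "schur_positive f \<longleftrightarrow> (\<exists>a. schur_expansion f a \<and> (\<forall>\<mu>. a \<mu> \<ge> 0))"

definition schur_F :: "int \<Rightarrow> int \<Rightarrow> int mfps" where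
  "schur_F r k =
     (schur_rep 3 (k - 2) [2, 2] + 2 * schur_rep 3 (k - 2) [2, 1] + schur_rep 3 (k - 1) [1]
      + schur_rep 3 (k - 2) [1, 1] + 2 * schur_rep 3 (k - 1) [] + schur_rep 3 (k - 2) [2])
       * schur_rep 3 (r - k) []
     - (schur_rep 3 (k - 1) [2] + schur_rep 3 (k - 1) [1])
       * (schur_rep 3 (r - k - 1) [2] + schur_rep 3 (r - k - 1) [1])"

end

theory Submission
  imports Defs "Jordan_Normal_Form.Determinant"
begin

text \<open>
  A partition whose columns have the lengths \<open>a \<ge> b \<ge> c\<close> has a Schur function that is a 3 by 3
  determinant in the elementary symmetric functions \<open>e\<^sub>m\<close>, and a partition with at most six columns
  has one that is a 6 by 6 determinant (the dual Jacobi--Trudi identity, \<open>schur_eq_jt\<close>). The theorem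
  follows from an explicit expansion: the symmetric function in question is the sum, over \<open>m = 0, 1, 2\<close>
  with multiplicities 1, 2, 1, of all Schur functions whose column lengths are
  \<open>a \<ge> p \<ge> p \<ge> q \<ge> q \<ge> f \<ge> 0\<close> with \<open>p + q = r - 1\<close> and \<open>a + f = r - m\<close>.

  To see this, fix \<open>p\<close> and \<open>q\<close> and sum the 6 by 6 determinants for \<open>(a, p, p, q, q, r - m - a)\<close>
  over \<open>a \<ge> p\<close>. Expanded along the first and the last row, the sum involves \<open>a\<close> only through the
  expressions \<open>e\<^bsub>a+i\<^esub> e\<^bsub>c-a+j\<^esub> - e\<^bsub>a+j\<^esub> e\<^bsub>c-a+i\<^esub>\<close>, and these telescope
  (\<open>telescope_antisymmetric\<close>). What is left is a polynomial in the \<open>e\<^sub>i\<close> with \<open>i\<close> near \<open>p\<close> or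
  near \<open>q\<close>, and this polynomial turns out to be a signed sum of six products of two 3 by 3
  determinants, one for column lengths near \<open>p\<close> and one for column lengths near \<open>q\<close>
  (\<open>sum_jt_6_eq_minors_0\<close>, \<open>sum_jt_6_eq_minors_1\<close>, \<open>sum_jt_6_eq_minors_2\<close>). These products are the ones
  occurring in \<open>schur_F\<close>: when \<open>p\<close> runs through all integers, they regroup into the sums
  \<open>F(r,k) + F(r,r-k)\<close> for \<open>0 \<le> k \<le> r\<close> (\<open>sum_paired_total\<close>). So the sum over all \<open>p\<close> is twice
  the function in question.

  It remains to halve. The six-term formula is invariant under \<open>p \<mapsto> r - 3 - p\<close>
  (\<open>paired_total_reflect\<close>), and for the values \<open>2p = r - 4, r - 3, r - 2\<close> near the centre of this
  reflection the determinants have two equal rows (\<open>paired_total_middle\<close>). So the function is the sum over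
  \<open>p \<ge> q\<close> alone. There the sequence \<open>a, p, p, q, q, r - m - a\<close> never rises by more than one, and a
  Jacobi--Trudi determinant of such a sequence is a Schur function or 0 (\<open>jt_eq_0_or_schur\<close>).
\<close>

section \<open>Expansions of determinants\<close>

text \<open>
  The enumeration of all indices other than \<open>i\<close>, as it arises from deleting a row or a column.
\<close>

definition skip :: "nat \<Rightarrow> nat \<Rightarrow> nat" where
  "skip i j = (if j < i then j else Suc j)"

lemma det_expand_row:
  fixes A :: "nat \<Rightarrow> nat \<Rightarrow> 'a :: comm_ring_1"
  assumes "i \<le> n"
  shows "det (mat (Suc n) (Suc n) (\<lambda>(i, j). A i j)) =
    (\<Sum>j<Suc n. (-1) ^ (i + j) * A i j * det (mat n n (\<lambda>(i', j'). A (skip i i') (skip j j'))))"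
proof -
  have "mat_delete (mat (Suc n) (Suc n) (\<lambda>(i, j). A i j)) i j =
      mat n n (\<lambda>(i', j'). A (skip i i') (skip j j'))" for j
    by (rule eq_matI) (auto simp: mat_delete_def skip_def)
  then show ?thesis
    using assms by (subst laplace_expansion_row[where i = i and n = "Suc n"])
      (auto simp del: sum.lessThan_Suc simp: cofactor_def mult_ac intro!: sum.cong)
qed

lemma det_expand_first_row:
  fixes A :: "nat \<Rightarrow> nat \<Rightarrow> 'a :: comm_ring_1"
  shows "det (mat (Suc n) (Suc n) (\<lambda>(i, j). A i j)) =
    (\<Sum>j<Suc n. (-1) ^ j * A 0 j * det (mat n n (\<lambda>(i, j'). A (Suc i) (skip j j'))))"
  by (subst det_expand_row[of 0]) (simp_all add: skip_def)

lemma det_mat_3: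
  fixes A :: "nat \<Rightarrow> nat \<Rightarrow> 'a :: comm_ring_1"
  shows "det (mat 3 3 (\<lambda>(i, j). A i j)) =
    A 0 0 * (A 1 1 * A 2 2 - A 1 2 * A 2 1) - A 0 1 * (A 1 0 * A 2 2 - A 1 2 * A 2 0)
    + A 0 2 * (A 1 0 * A 2 1 - A 1 1 * A 2 0)"
  by (simp add: numeral_eq_Suc det_expand_first_row skip_def det_dim_zero algebra_simps)

lemma det_mat_4:
  fixes A :: "nat \<Rightarrow> nat \<Rightarrow> 'a :: comm_ring_1"
  shows "det (mat 4 4 (\<lambda>(i, j). A i j)) =
      (A 0 0 * A 1 1 - A 0 1 * A 1 0) * (A 2 2 * A 3 3 - A 2 3 * A 3 2)
    - (A 0 0 * A 1 2 - A 0 2 * A 1 0) * (A 2 1 * A 3 3 - A 2 3 * A 3 1)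
    + (A 0 0 * A 1 3 - A 0 3 * A 1 0) * (A 2 1 * A 3 2 - A 2 2 * A 3 1)
    + (A 0 1 * A 1 2 - A 0 2 * A 1 1) * (A 2 0 * A 3 3 - A 2 3 * A 3 0)
    - (A 0 1 * A 1 3 - A 0 3 * A 1 1) * (A 2 0 * A 3 2 - A 2 2 * A 3 0)
    + (A 0 2 * A 1 3 - A 0 3 * A 1 2) * (A 2 0 * A 3 1 - A 2 1 * A 3 0)"
  by (simp add: numeral_eq_Suc det_expand_first_row skip_def det_dim_zero algebra_simps)

lemma det_mat_leibniz:
  fixes A :: "nat \<Rightarrow> nat \<Rightarrow> 'a :: comm_ring_1"
  shows "det (mat n n (\<lambda>(i, j). A i j)) = (\<Sum>p | p permutes {..<n}. signof p * (\<Prod>i<n. A i (p i)))"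
  by (subst det_def'[of _ n])
     (auto intro!: sum.cong prod.cong arg_cong2[where f = "(*)"] simp: atLeast0LessThan permutes_in_image
       dest: permutes_in_image[of _ "{..<n}"])

text \<open>
  Multilinearity in all rows at once. It will serve for adjoining a variable \<open>x\<close> to the
  elementary symmetric polynomials, whose recursion has the form \<open>f + x g\<close>.
\<close>

lemma det_add_rows:
  fixes f g :: "nat \<Rightarrow> nat \<Rightarrow> 'a :: comm_ring_1"
  shows "det (mat w w (\<lambda>(i, j). f i j + x * g i j)) =
    (\<Sum>S\<in>Pow {..<w}. x ^ card S * det (mat w w (\<lambda>(i, j). if i \<in> S then g i j else f i j)))"
proof -
  have expand: "(\<Prod>i<w. f i (p i) + x * g i (p i)) =
      (\<Sum>S\<in>Pow {..<w}. x ^ card S * (\<Prod>i<w. if i \<in> S then g i (p i) else f i (p i)))" for p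
  proof -
    have "(\<Prod>i<w. f i (p i) + x * g i (p i)) =
        (\<Sum>S\<in>Pow {..<w}. (\<Prod>i\<in>S. x * g i (p i)) * (\<Prod>i\<in>{..<w} - S. f i (p i)))"
      by (subst add.commute) (simp add: prod_add)
    also have "\<dots> = (\<Sum>S\<in>Pow {..<w}. x ^ card S * (\<Prod>i<w. if i \<in> S then g i (p i) else f i (p i)))"
    proof (intro sum.cong refl)
      fix S
      assume "S \<in> Pow {..<w}"
      then have "{..<w} \<inter> S = S" "{..<w} \<inter> - S = {..<w} - S"
        by auto
      then show "(\<Prod>i\<in>S. x * g i (p i)) * (\<Prod>i\<in>{..<w} - S. f i (p i)) =
          x ^ card S * (\<Prod>i<w. if i \<in> S then g i (p i) else f i (p i))"
        by (simp add: prod.If_cases prod.distrib mult.assoc)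
    qed
    finally show ?thesis .
  qed
  have "det (mat w w (\<lambda>(i, j). f i j + x * g i j)) = (\<Sum>p | p permutes {..<w}. \<Sum>S\<in>Pow {..<w}.
      x ^ card S * (signof p * (\<Prod>i<w. if i \<in> S then g i (p i) else f i (p i))))"
    by (simp add: det_mat_leibniz expand sum_distrib_left mult.left_commute)
  also have "\<dots> = (\<Sum>S\<in>Pow {..<w}. \<Sum>p | p permutes {..<w}.
      x ^ card S * (signof p * (\<Prod>i<w. if i \<in> S then g i (p i) else f i (p i))))"
    by (rule sum.swap)
  finally show ?thesis
    by (simp add: det_mat_leibniz sum_distrib_left)
qed

lemma sum_skip:
  fixes g :: "nat \<Rightarrow> 'a :: ab_group_add"
  assumes "j \<le> n"
  shows "(\<Sum>i<n. g (skip j i)) = (\<Sum>k<j. g k) + (\<Sum>k\<in>{j<..n}. g k)"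
proof -
  have "(\<Sum>i<n. g (skip j i)) = (\<Sum>i<j. g (skip j i)) + (\<Sum>i\<in>{j..<n}. g (skip j i))"
    using assms sum.atLeastLessThan_concat[of 0 j n "\<lambda>i. g (skip j i)"] by (simp add: atLeast0LessThan)
  moreover have "(\<Sum>i\<in>{j..<n}. g (skip j i)) = (\<Sum>k\<in>{j<..n}. g k)"
    by (rule sum.reindex_bij_witness[where i = "\<lambda>k. k - 1" and j = Suc]) (auto simp: skip_def)
  moreover have "(\<Sum>i<j. g (skip j i)) = (\<Sum>k<j. g k)"
    by (rule sum.cong) (auto simp: skip_def)
  ultimately show ?thesis
    by (simp only:)
qed

text \<open>
  The sum over ordered pairs that arises when two rows are expanded one after the other, collected
  into 2 by 2 minors of these two rows; \<open>K\<close> stands for the complementary minors.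
\<close>

lemma sum_skip_pairs:
  fixes K :: "nat \<Rightarrow> nat \<Rightarrow> 'a :: comm_ring_1"
  assumes K: "\<And>i j. j \<le> i \<Longrightarrow> K i j = K j (Suc i)"
  shows "(\<Sum>j<Suc n. (-1) ^ j * a j * (\<Sum>i<n. (-1) ^ i * b (skip j i) * K i j)) =
   - (\<Sum>j<Suc n. \<Sum>i<j. (-1) ^ (i + j) * (a i * b j - a j * b i) * K i j)"
proof -
  let ?t = "\<lambda>i j. (-1) ^ (i + j) * a j * b i * K i j" and ?u = "\<lambda>i j. (-1) ^ (i + j) * a i * b j * K i j"
  \<comment> \<open>Deleting \<open>j\<close> and then the \<open>i\<close>-th of the remaining indices deletes the pair \<open>j\<close>, \<open>skip j i\<close>;
    the sign of the pair depends on which of the two is smaller.\<close>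
  have "(\<Sum>j<Suc n. (-1) ^ j * a j * (\<Sum>i<n. (-1) ^ i * b (skip j i) * K i j)) =
    (\<Sum>j<Suc n. \<Sum>i<n. (\<lambda>k. if k < j then ?t k j else - ?u j k) (skip j i))"
  proof (intro sum.cong refl, unfold sum_distrib_left, intro sum.cong refl)
    fix i j
    show "(-1) ^ j * a j * ((-1) ^ i * b (skip j i) * K i j) =
        (\<lambda>k. if k < j then ?t k j else - ?u j k) (skip j i)"
    proof (cases "i < j")
      case True
      then show ?thesis
        by (simp add: skip_def power_add mult_ac)
    next
      case False
      with K[of j i] show ?thesis
        by (simp add: skip_def power_add mult_ac)
    qed
  qed
  also have "\<dots> = (\<Sum>j<Suc n. (\<Sum>k<j. ?t k j) + (\<Sum>k\<in>{j<..n}. - ?u j k))"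
    by (intro sum.cong refl, subst sum_skip) (auto intro!: arg_cong2[where f = "(+)"] sum.cong)
  also have "\<dots> = (\<Sum>j<Suc n. \<Sum>k<j. ?t k j) - (\<Sum>j<Suc n. \<Sum>k\<in>{j<..n}. ?u j k)"
    by (simp add: sum_subtractf sum_negf del: sum.lessThan_Suc)
  also have "(\<Sum>j<Suc n. \<Sum>k\<in>{j<..n}. ?u j k) = (\<Sum>k<Suc n. \<Sum>j<k. ?u j k)"
    by (subst (1 2) sum.Sigma, simp, simp, simp, simp)
       (rule sum.reindex_bij_witness[where i = prod.swap and j = prod.swap], auto)
  finally show ?thesis
    by (simp add: sum_subtractf[symmetric] sum_negf[symmetric] algebra_simps del: sum.lessThan_Suc)
qed

lemma skip_skip: "j \<le> i \<Longrightarrow> skip j (skip i c) = skip (Suc i) (skip j c)"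
  by (auto simp: skip_def)

text \<open>
  Laplace expansion along the first and the last row together.
\<close>

lemma det_6_outer_rows:
  fixes a b :: "nat \<Rightarrow> 'a :: comm_ring_1"
  shows "det (mat 6 6 (\<lambda>(i, j). if i = 0 then a j else if i = 5 then b j else R (i - 1) j)) =
    (\<Sum>j<6. \<Sum>i<j. (-1) ^ (i + j + 1) * (a i * b j - a j * b i) *
       det (mat 4 4 (\<lambda>(s, c). R s (skip j (skip i c)))))"
proof -
  define K where "K i j = det (mat 4 4 (\<lambda>(s, c). R s (skip j (skip i c))))" for i j
  have K: "K i j = K j (Suc i)" if "j \<le> i" for i j
    using that by (simp add: K_def skip_skip)
  have "det (mat 6 6 (\<lambda>(i, j). if i = 0 then a j else if i = 5 then b j else R (i - 1) j)) =
    (\<Sum>j<6. (-1) ^ j * a j * det (mat 5 5 (\<lambda>(i, j'). if i = 4 then b (skip j j') else R i (skip j j'))))"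
    using det_expand_first_row[of 5 "\<lambda>i j. if i = 0 then a j else if i = 5 then b j else R (i - 1) j"]
    by (simp only: numeral_eq_Suc pred_numeral_simps diff_Suc_1) simp
  also have "\<dots> = (\<Sum>j<6. (-1) ^ j * a j * (\<Sum>i<5. (-1) ^ i * b (skip j i) * K i j))"
  proof (intro sum.cong refl arg_cong2[where f = "(*)"])
    fix j
    have "det (mat 4 4 (\<lambda>(s, c). if skip 4 s = 4 then x c else R (skip 4 s) (y c))) =
       det (mat 4 4 (\<lambda>(s, c). R s (y c)))" for x y
      by (intro arg_cong[where f = det] cong_mat) (auto simp: skip_def)
    then show "det (mat 5 5 (\<lambda>(i, j'). if i = 4 then b (skip j j') else R i (skip j j'))) =
        (\<Sum>i<5. (-1) ^ i * b (skip j i) * K i j)"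
      using det_expand_row[of 4 4 "\<lambda>i j'. if i = 4 then b (skip j j') else R i (skip j j')"]
      by (simp add: K_def power_add)
  qed
  also have "\<dots> = (\<Sum>j<6. \<Sum>i<j. (-1) ^ (i + j + 1) * (a i * b j - a j * b i) * K i j)"
    using sum_skip_pairs[where K = K and n = 5 and a = a and b = b] K
    by (simp add: sum_negf[symmetric] del: sum.lessThan_Suc)
  finally show ?thesis
    by (simp add: K_def)
qed

section \<open>Jacobi--Trudi determinants\<close>

text \<open>
  For column lengths \<open>\<alpha>\<close> and \<open>e\<close> the elementary symmetric functions this is the dual
  Jacobi--Trudi determinant. It is defined for arbitrary integer sequences \<open>\<alpha>\<close> because the
  determinants of those other sequences that arise below vanish, so that sums over \<open>\<alpha>\<close> need
  no side conditions.
\<close>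

definition jt :: "(int \<Rightarrow> 'a :: comm_ring_1) \<Rightarrow> nat \<Rightarrow> (nat \<Rightarrow> int) \<Rightarrow> 'a" where
  "jt e w \<alpha> = det (mat w w (\<lambda>(i, j). e (\<alpha> i + int j - int i)))"

lemma jt_cong: "(\<And>i. i < w \<Longrightarrow> \<alpha> i = \<beta> i) \<Longrightarrow> jt e w \<alpha> = jt e w \<beta>"
  unfolding jt_def by (intro arg_cong[where f = det] cong_mat) auto

lemma jt_equal_rows:
  assumes "i < w" "k < w" "i \<noteq> k" "\<alpha> i - int i = \<alpha> k - int k"
  shows "jt e w \<alpha> = 0"
proof -
  have "\<alpha> i = \<alpha> k - int k + int i"
    using assms(4) by simp
  then show ?thesis
    unfolding jt_def using assms(1-3)
    by (intro det_identical_rows[of _ w i k]) (auto intro!: eq_vecI arg_cong[where f = e])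
qed

lemma jt_negative_last:
  assumes neg: "\<And>m. m < 0 \<Longrightarrow> e m = 0" and "\<alpha> w < 0"
  shows "jt e (Suc w) \<alpha> = 0"
  unfolding jt_def using assms by (subst det_expand_row[of w]) simp_all

definition column_lengths :: "nat \<Rightarrow> (nat \<Rightarrow> int) \<Rightarrow> bool" where
  "column_lengths w \<alpha> \<longleftrightarrow> (\<forall>j. Suc j < w \<longrightarrow> \<alpha> (Suc j) \<le> \<alpha> j) \<and> (\<forall>j<w. 0 \<le> \<alpha> j)"

text \<open>
  An ascent can only be by one, and then two adjacent rows are equal. Without an ascent, the last
  length is negative, which makes the last row 0.
\<close>

lemma jt_not_column_lengths:
  assumes neg: "\<And>m. m < 0 \<Longrightarrow> e m = 0"
    and \<alpha>: "\<And>j. Suc j < w \<Longrightarrow> \<alpha> (Suc j) \<le> \<alpha> j + 1" and "\<not> column_lengths w \<alpha>"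
  shows "jt e w \<alpha> = 0"
proof (cases "\<exists>j. Suc j < w \<and> \<alpha> j < \<alpha> (Suc j)")
  case True
  then obtain j where j: "Suc j < w" "\<alpha> j < \<alpha> (Suc j)"
    by blast
  with \<alpha>[of j] show ?thesis
    by (intro jt_equal_rows[of j _ "Suc j"]) auto
next
  case False
  with assms(3) obtain j where j: "j < w" "\<alpha> j < 0"
    by (force simp: column_lengths_def)
  have "\<alpha> k < 0" if "j \<le> k" "k < w" for k
    using that
  proof (induction k rule: dec_induct)
    case (step k)
    with False show ?case
      by force
  qed (use j in simp)
  with j have "\<alpha> (w - 1) < 0" "w = Suc (w - 1)"
    by auto
  with jt_negative_last[OF neg, where \<alpha> = \<alpha> and w = "w - 1"] show ?thesis
    by simp
qed

section \<open>Monomials and truncation to finitely many variables\<close>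

lemma mcoeff_sum: "mcoeff (\<Sum>x\<in>A. f x :: 'a :: comm_ring_1 mfps) M = (\<Sum>x\<in>A. mcoeff (f x) M)"
  by (induction A rule: infinite_finite_induct) (simp_all add: mcoeff_simps)

definition monom_of :: "nat multiset \<Rightarrow> int mfps" where
  "monom_of A = Abs_mfps (\<lambda>M. if M = A then 1 else 0)"

lemma mcoeff_monom_of: "mcoeff (monom_of A) M = (if M = A then 1 else 0)"
  by (simp add: monom_of_def)

lemma monom_of_add: "monom_of (A + B) = monom_of A * monom_of B"
proof (rule mfps_eqI)
  fix M
  have "mcoeff (monom_of A * monom_of B) M = (\<Sum>p | fst p + snd p = M. if p = (A, B) then 1 else 0)"
    unfolding mcoeff_mult case_prod_unfold
    by (rule sum.cong) (auto simp: mcoeff_monom_of)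
  also have "\<dots> = mcoeff (monom_of (A + B)) M"
    using finite_multiset_splits[of M] by (auto simp: case_prod_unfold mcoeff_monom_of)
  finally show "mcoeff (monom_of (A + B)) M = mcoeff (monom_of A * monom_of B) M" ..
qed

lemma monom_of_empty: "monom_of {#} = 1"
  by (rule mfps_eqI) (simp add: mcoeff_monom_of mcoeff_simps)

lemma monom_of_replicate: "monom_of (replicate_mset k x) = monom_of {#x#} ^ k"
proof (induction k)
  case (Suc k)
  have "replicate_mset (Suc k) x = {#x#} + replicate_mset k x"
    by simp
  with Suc show ?case
    by (simp only: monom_of_add power_Suc)
qed (simp add: monom_of_empty)

text \<open>
  Setting all variables from the \<open>n\<close>-th on to 0. The Jacobi--Trudi identity is proved by
  induction on the number of variables and then lifted along these ring homomorphisms.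
\<close>

definition trunc_vars :: "nat \<Rightarrow> int mfps \<Rightarrow> int mfps" where
  "trunc_vars n f = Abs_mfps (\<lambda>M. if set_mset M \<subseteq> {..<n} then mcoeff f M else 0)"

lemma mcoeff_trunc_vars:
  "mcoeff (trunc_vars n f) M = (if set_mset M \<subseteq> {..<n} then mcoeff f M else 0)"
  by (simp add: trunc_vars_def)

lemma mfps_eq_trunc_varsI:
  assumes "\<And>n. trunc_vars n f = trunc_vars n g"
  shows "f = g"
proof (rule mfps_eqI)
  fix M :: "nat multiset"
  obtain n where "set_mset M \<subseteq> {..<n}"
    using finite_nat_iff_bounded[of "set_mset M"] by auto
  then show "mcoeff f M = mcoeff g M"
    using assms[of n] mcoeff_trunc_vars[of n f M] mcoeff_trunc_vars[of n g M] by simp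
qed

lemma trunc_vars_mult: "trunc_vars n (f * g) = trunc_vars n f * trunc_vars n g"
proof (rule mfps_eqI)
  fix M :: "nat multiset"
  show "mcoeff (trunc_vars n (f * g)) M = mcoeff (trunc_vars n f * trunc_vars n g) M"
  proof (cases "set_mset M \<subseteq> {..<n}")
    case True
    then show ?thesis
      unfolding mcoeff_mult mcoeff_trunc_vars by (auto intro!: sum.cong)
  next
    case False
    then have "(\<Sum>(A, B) | A + B = M. mcoeff (trunc_vars n f) A * mcoeff (trunc_vars n g) B) = 0"
      by (intro sum.neutral) (auto simp: mcoeff_trunc_vars)
    with False show ?thesis
      by (simp add: mcoeff_mult mcoeff_trunc_vars)
  qed
qed

lemma comm_ring_hom_trunc_vars: "comm_ring_hom (trunc_vars n)"
proof
  show "trunc_vars n (f * g) = trunc_vars n f * trunc_vars n g" for f g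
    by (rule trunc_vars_mult)
qed (auto intro!: mfps_eqI simp: mcoeff_trunc_vars mcoeff_simps)

section \<open>Removing the largest entry from tableaux\<close>

definition shape :: "nat \<Rightarrow> (nat \<Rightarrow> int) \<Rightarrow> (nat \<times> nat) set" where
  "shape w \<alpha> = {(i, j). j < w \<and> int i < \<alpha> j}"

lemma mem_shape: "(i, j) \<in> shape w \<alpha> \<longleftrightarrow> j < w \<and> int i < \<alpha> j"
  by (simp add: shape_def)

lemma finite_shape [simp]: "finite (shape w \<alpha>)"
proof (rule finite_subset)
  show "shape w \<alpha> \<subseteq> (\<Union>j<w. {..<nat (\<alpha> j)} \<times> {j})"
    by (auto simp: shape_def)
qed simp

definition tableaux :: "nat \<Rightarrow> (nat \<times> nat) set \<Rightarrow> (nat \<times> nat \<Rightarrow> nat) set" where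
  "tableaux n D = {T \<in> extensional D. (\<forall>c\<in>D. T c < n) \<and>
     (\<forall>i j. (i, j) \<in> D \<and> (i, Suc j) \<in> D \<longrightarrow> T (i, j) \<le> T (i, Suc j)) \<and>
     (\<forall>i j. (i, j) \<in> D \<and> (Suc i, j) \<in> D \<longrightarrow> T (i, j) < T (Suc i, j))}"

lemma finite_tableaux:
  assumes "finite D"
  shows "finite (tableaux n D)"
proof (rule finite_subset)
  show "tableaux n D \<subseteq> D \<rightarrow>\<^sub>E {..<n}"
    by (auto simp: tableaux_def PiE_def)
  show "finite (D \<rightarrow>\<^sub>E {..<n})"
    using assms by (intro finite_PiE) auto
qed

definition weight :: "(nat \<times> nat) set \<Rightarrow> (nat \<times> nat \<Rightarrow> nat) \<Rightarrow> int mfps" where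
  "weight D T = monom_of (image_mset T (mset_set D))"

definition schur_poly :: "nat \<Rightarrow> (nat \<times> nat) set \<Rightarrow> int mfps" where
  "schur_poly n D = (\<Sum>T\<in>tableaux n D. weight D T)"

lemma trunc_vars_schur:
  assumes "is_partition \<mu>"
  shows "trunc_vars n (schur \<mu>) = schur_poly n (cells \<mu>)"
proof (rule mfps_eqI)
  fix M :: "nat multiset"
  have "mcoeff (schur_poly n (cells \<mu>)) M =
      int (card {T \<in> tableaux n (cells \<mu>). Defs.content \<mu> T = M})"
    by (simp add: schur_poly_def mcoeff_sum weight_def mcoeff_monom_of Defs.content_def finite_tableaux
        sum.If_cases Int_def eq_commute[of M])
  also have "{T \<in> tableaux n (cells \<mu>). Defs.content \<mu> T = M} =
      (if set_mset M \<subseteq> {..<n} then {T \<in> ssyt \<mu>. Defs.content \<mu> T = M} else {})"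
    by (auto simp: tableaux_def ssyt_def Defs.content_def image_subset_iff)
  finally show "mcoeff (trunc_vars n (schur \<mu>)) M = mcoeff (schur_poly n (cells \<mu>)) M"
    using assms by (simp add: mcoeff_trunc_vars schur_def)
qed

definition shorten :: "(nat \<Rightarrow> int) \<Rightarrow> nat set \<Rightarrow> nat \<Rightarrow> int" where
  "shorten \<alpha> S j = \<alpha> j - (if j \<in> S then 1 else 0)"

definition max_columns :: "nat \<Rightarrow> (nat \<times> nat) set \<Rightarrow> (nat \<times> nat \<Rightarrow> nat) \<Rightarrow> nat set" where
  "max_columns n D T = {j. \<exists>i. (i, j) \<in> D \<and> T (i, j) = n}"

text \<open>
  Inverse to restricting a tableau to \<open>D'\<close>: all other cells of \<open>D\<close> receive the entry \<open>n\<close>.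
\<close>

definition fill_with :: "nat \<Rightarrow> (nat \<times> nat) set \<Rightarrow> (nat \<times> nat) set \<Rightarrow> (nat \<times> nat \<Rightarrow> nat) \<Rightarrow>
    nat \<times> nat \<Rightarrow> nat" where
  "fill_with n D D' T = restrict (\<lambda>c. if c \<in> D' then T c else n) D"

lemma tableaux_column_strict:
  assumes T: "T \<in> tableaux n (shape w \<alpha>)" and "i < k" "(k, j) \<in> shape w \<alpha>"
  shows "T (i, j) < T (k, j)"
  using assms(2, 3)
proof (induction k)
  case (Suc k)
  then have k: "(k, j) \<in> shape w \<alpha>"
    by (auto simp: mem_shape)
  with T Suc.prems have "T (k, j) < T (Suc k, j)"
    by (auto simp: tableaux_def)
  with Suc k show ?case
    by (cases "i = k") auto
qed simp

text \<open>
  Columns are strictly increasing, so a maximal entry can only occur at the bottom of a column.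
  A tableau with entries at most \<open>n\<close> is therefore determined by the set of columns that
  end in \<open>n\<close> and by the rest, which is a tableau with these columns shortened.
\<close>

lemma max_entry_iff:
  assumes T: "T \<in> tableaux (Suc n) (shape w \<alpha>)" and c: "(i, j) \<in> shape w \<alpha>"
  shows "T (i, j) = n \<longleftrightarrow> j \<in> max_columns n (shape w \<alpha>) T \<and> int i = \<alpha> j - 1"
proof
  assume n: "T (i, j) = n"
  have "int i = \<alpha> j - 1"
  proof (rule ccontr)
    assume "int i \<noteq> \<alpha> j - 1"
    with c have "(Suc i, j) \<in> shape w \<alpha>"
      by (auto simp: mem_shape)
    with tableaux_column_strict[OF T, of i "Suc i" j] T n show False
      by (auto simp: tableaux_def less_Suc_eq)
  qed
  with n c show "j \<in> max_columns n (shape w \<alpha>) T \<and> int i = \<alpha> j - 1"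
    by (auto simp: max_columns_def)
next
  assume "j \<in> max_columns n (shape w \<alpha>) T \<and> int i = \<alpha> j - 1"
  then obtain k where k: "(k, j) \<in> shape w \<alpha>" "T (k, j) = n" and i: "int i = \<alpha> j - 1"
    by (auto simp: max_columns_def)
  then have "k \<le> i"
    by (auto simp: mem_shape)
  moreover have "\<not> k < i"
    using tableaux_column_strict[OF T, of k i j] c k T by (auto simp: tableaux_def less_Suc_eq)
  ultimately show "T (i, j) = n"
    using k by simp
qed

lemma shape_shorten_max_columns:
  assumes "T \<in> tableaux (Suc n) (shape w \<alpha>)"
  shows "shape w (shorten \<alpha> (max_columns n (shape w \<alpha>) T)) = {c \<in> shape w \<alpha>. T c \<noteq> n}"
proof (rule Set.set_eqI, clarify)
  fix i j
  show "(i, j) \<in> shape w (shorten \<alpha> (max_columns n (shape w \<alpha>) T)) \<longleftrightarrow>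
      (i, j) \<in> {c \<in> shape w \<alpha>. T c \<noteq> n}"
    using max_entry_iff[OF assms, of i j] by (auto simp: mem_shape shorten_def split: if_splits)
qed

text \<open>
  The rows are weakly increasing, so among columns of equal length those that end in \<open>n\<close> come
  last.
\<close>

lemma column_lengths_shorten_max_columns:
  assumes T: "T \<in> tableaux (Suc n) (shape w \<alpha>)" and \<alpha>: "column_lengths w \<alpha>"
  shows "column_lengths w (shorten \<alpha> (max_columns n (shape w \<alpha>) T))"
proof -
  let ?S = "max_columns n (shape w \<alpha>) T"
  have nonneg: "0 \<le> shorten \<alpha> ?S j" if "j < w" for j
    using \<alpha> that by (auto simp: column_lengths_def shorten_def max_columns_def mem_shape)
  have "shorten \<alpha> ?S (Suc j) \<le> shorten \<alpha> ?S j" if j: "Suc j < w" for j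
  proof (rule ccontr)
    assume "\<not> ?thesis"
    with \<alpha> j have S: "j \<in> ?S" "Suc j \<notin> ?S" and eq: "\<alpha> (Suc j) = \<alpha> j"
      by (auto simp: column_lengths_def shorten_def split: if_splits)
    \<comment> \<open>The bottom cell of column \<open>j\<close> contains \<open>n\<close>, hence so does its right neighbour.\<close>
    define i where "i = nat (\<alpha> j - 1)"
    from S(1) have "\<alpha> j \<ge> 1"
      by (auto simp: max_columns_def mem_shape)
    with j eq have i: "(i, j) \<in> shape w \<alpha>" "(i, Suc j) \<in> shape w \<alpha>" "int i = \<alpha> j - 1"
      by (auto simp: i_def mem_shape)
    with max_entry_iff[OF T i(1)] S have "T (i, j) = n"
      by simp
    moreover have "T (i, j) \<le> T (i, Suc j)" "T (i, Suc j) < Suc n"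
      using T i by (auto simp: tableaux_def)
    ultimately have "T (i, Suc j) = n"
      by simp
    with i(2) S(2) show False
      by (auto simp: max_columns_def)
  qed
  with nonneg show ?thesis
    by (auto simp: column_lengths_def)
qed

lemma restrict_tableaux:
  assumes T: "T \<in> tableaux (Suc n) (shape w \<alpha>)"
  defines "D \<equiv> shape w (shorten \<alpha> (max_columns n (shape w \<alpha>) T))"
  shows "restrict T D \<in> tableaux n D" and "fill_with n (shape w \<alpha>) D (restrict T D) = T"
proof -
  have D: "D = {c \<in> shape w \<alpha>. T c \<noteq> n}"
    unfolding D_def by (rule shape_shorten_max_columns[OF T])
  show "restrict T D \<in> tableaux n D"
    using T by (auto simp: tableaux_def D less_Suc_eq)
  show "fill_with n (shape w \<alpha>) D (restrict T D) = T"
    using T by (auto simp: tableaux_def D fill_with_def fun_eq_iff extensional_def)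
qed

lemma fill_tableaux:
  assumes \<alpha>: "column_lengths w (shorten \<alpha> S)" and S: "S \<subseteq> {..<w}"
    and T: "T \<in> tableaux n (shape w (shorten \<alpha> S))"
  defines "U \<equiv> fill_with n (shape w \<alpha>) (shape w (shorten \<alpha> S)) T"
  shows "U \<in> tableaux (Suc n) (shape w \<alpha>)" and "max_columns n (shape w \<alpha>) U = S"
    and "restrict U (shape w (shorten \<alpha> S)) = T"
proof -
  let ?D = "shape w \<alpha>" and ?D' = "shape w (shorten \<alpha> S)"
  have sub: "c \<in> ?D" if "c \<in> ?D'" for c
    using that by (auto simp: shape_def shorten_def split: if_splits)
  have T_less: "T c < n" if "c \<in> ?D'" for c
    using T that by (auto simp: tableaux_def)
  have U_in: "U c = T c" if "c \<in> ?D'" for c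
    using that sub by (simp add: U_def fill_with_def)
  have U_out: "U c = n" if "c \<in> ?D" "c \<notin> ?D'" for c
    using that by (simp add: U_def fill_with_def)
  have U_le: "U c \<le> n" if "c \<in> ?D" for c
    using that U_in[of c] U_out[of c] T_less[of c] by (cases "c \<in> ?D'") auto
  have left: "(i, j) \<in> ?D'" if "(i, Suc j) \<in> ?D'" for i j
  proof -
    have "Suc j < w" "int i < shorten \<alpha> S (Suc j)"
      using that by (auto simp: mem_shape)
    moreover have "shorten \<alpha> S (Suc j) \<le> shorten \<alpha> S j"
      using \<alpha> \<open>Suc j < w\<close> by (auto simp: column_lengths_def)
    ultimately show ?thesis
      by (auto simp: mem_shape)
  qed
  have above: "(i, j) \<in> ?D'" if "(Suc i, j) \<in> ?D" for i j
    using that by (auto simp: mem_shape shorten_def)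
  have row: "U (i, j) \<le> U (i, Suc j)" if "(i, j) \<in> ?D" "(i, Suc j) \<in> ?D" for i j
  proof (cases "(i, Suc j) \<in> ?D'")
    case True
    with left[OF True] T show ?thesis
      by (simp add: U_in tableaux_def)
  next
    case False
    with that U_le[OF that(1)] show ?thesis
      by (simp add: U_out)
  qed
  have col: "U (i, j) < U (Suc i, j)" if "(i, j) \<in> ?D" "(Suc i, j) \<in> ?D" for i j
  proof (cases "(Suc i, j) \<in> ?D'")
    case True
    with above[OF that(2)] T show ?thesis
      by (simp add: U_in tableaux_def)
  next
    case False
    with that above[OF that(2)] T_less show ?thesis
      by (simp add: U_out U_in)
  qed
  show "U \<in> tableaux (Suc n) ?D"
    using row col U_le by (auto simp: tableaux_def less_Suc_eq_le) (auto simp: U_def fill_with_def)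
  have "c \<in> ?D \<and> U c = n \<longleftrightarrow> c \<in> ?D \<and> c \<notin> ?D'" for c
    using U_in[of c] U_out[of c] T_less[of c] by fastforce
  then have "max_columns n ?D U = {j. \<exists>i. (i, j) \<in> ?D \<and> (i, j) \<notin> ?D'}"
    unfolding max_columns_def by blast
  also have "\<dots> = S"
  proof (rule Set.set_eqI, rule iffI)
    fix j
    assume j: "j \<in> S"
    with S \<alpha> have "shorten \<alpha> S j \<ge> 0" "j < w"
      by (auto simp: column_lengths_def)
    with j have "(nat (\<alpha> j - 1), j) \<in> ?D" "(nat (\<alpha> j - 1), j) \<notin> ?D'"
      by (auto simp: mem_shape shorten_def)
    then show "j \<in> {j. \<exists>i. (i, j) \<in> ?D \<and> (i, j) \<notin> ?D'}"
      by blast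
  qed (auto simp: mem_shape shorten_def split: if_splits)
  finally show "max_columns n ?D U = S" .
  show "restrict U ?D' = T"
    using T U_in by (auto simp: tableaux_def fun_eq_iff extensional_def)
qed

lemma weight_restrict:
  assumes T: "T \<in> tableaux (Suc n) (shape w \<alpha>)"
  defines "S \<equiv> max_columns n (shape w \<alpha>) T"
  defines "D \<equiv> shape w (shorten \<alpha> S)"
  shows "weight (shape w \<alpha>) T = monom_of {#n#} ^ card S * weight D (restrict T D)"
proof -
  have D: "D = {c \<in> shape w \<alpha>. T c \<noteq> n}"
    unfolding D_def S_def by (rule shape_shorten_max_columns[OF T])
  let ?N = "{c \<in> shape w \<alpha>. T c = n}"
  have "bij_betw (\<lambda>j. (nat (\<alpha> j - 1), j)) S ?N"
  proof (rule bij_betwI[where g = snd])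
    show "(\<lambda>j. (nat (\<alpha> j - 1), j)) \<in> S \<rightarrow> ?N"
    proof
      fix j
      assume j: "j \<in> S"
      then have "(nat (\<alpha> j - 1), j) \<in> shape w \<alpha>" "int (nat (\<alpha> j - 1)) = \<alpha> j - 1"
        by (auto simp: S_def max_columns_def mem_shape)
      with max_entry_iff[OF T] j show "(nat (\<alpha> j - 1), j) \<in> ?N"
        by (auto simp: S_def)
    qed
    show "snd \<in> ?N \<rightarrow> S"
      by (auto simp: S_def max_columns_def)
    show "(nat (\<alpha> (snd c) - 1), snd c) = c" if "c \<in> ?N" for c
      using that max_entry_iff[OF T, of "fst c" "snd c"] by (cases c) auto
  qed simp
  then have card: "card S = card ?N"
    by (rule bij_betw_same_card)
  have fin: "finite D"
    unfolding D_def by simp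
  have "mset_set (shape w \<alpha>) = mset_set ?N + mset_set D"
    unfolding D by (subst mset_set_Union[symmetric]) (auto intro!: arg_cong[where f = mset_set])
  then have "image_mset T (mset_set (shape w \<alpha>)) =
      image_mset T (mset_set ?N) + image_mset T (mset_set D)"
    by simp
  also have "image_mset T (mset_set ?N) = image_mset (\<lambda>_. n) (mset_set ?N)"
    by (rule image_mset_cong) (auto dest: elem_mset_set[THEN iffD1, rotated])
  also have "\<dots> = replicate_mset (card S) n"
    by (simp add: card image_mset_const_eq)
  also have "image_mset T (mset_set D) = image_mset (restrict T D) (mset_set D)"
    using fin by (intro image_mset_cong) simp
  finally show ?thesis
    by (simp add: weight_def monom_of_add monom_of_replicate)
qed

text \<open>
  The branching rule of Schur polynomials: the sum ranges over the removals of horizontal strips.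
\<close>

lemma schur_poly_Suc:
  assumes \<alpha>: "column_lengths w \<alpha>"
  shows "schur_poly (Suc n) (shape w \<alpha>) =
    (\<Sum>S | S \<subseteq> {..<w} \<and> column_lengths w (shorten \<alpha> S).
       monom_of {#n#} ^ card S * schur_poly n (shape w (shorten \<alpha> S)))"
proof -
  let ?A = "{S. S \<subseteq> {..<w} \<and> column_lengths w (shorten \<alpha> S)}"
  let ?D = "\<lambda>S. shape w (shorten \<alpha> S)"
  have fin: "finite ?A"
    by (rule finite_subset[of _ "Pow {..<w}"]) auto
  have sub: "max_columns n (shape w \<alpha>) T \<subseteq> {..<w}" for T
    by (auto simp: max_columns_def mem_shape)
  have "schur_poly (Suc n) (shape w \<alpha>) = (\<Sum>(S, T)\<in>Sigma ?A (\<lambda>S. tableaux n (?D S)).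
      monom_of {#n#} ^ card S * weight (?D S) T)"
    unfolding schur_poly_def
  proof (rule sum.reindex_bij_witness[where
        i = "\<lambda>(S, T). fill_with n (shape w \<alpha>) (?D S) T" and
        j = "\<lambda>T. (max_columns n (shape w \<alpha>) T, restrict T (?D (max_columns n (shape w \<alpha>) T)))"])
    fix T
    assume T: "T \<in> tableaux (Suc n) (shape w \<alpha>)"
    show "(case (max_columns n (shape w \<alpha>) T, restrict T (?D (max_columns n (shape w \<alpha>) T))) of
        (S, T) \<Rightarrow> fill_with n (shape w \<alpha>) (?D S) T) = T"
      using restrict_tableaux(2)[OF T] by simp
    show "(max_columns n (shape w \<alpha>) T, restrict T (?D (max_columns n (shape w \<alpha>) T)))
        \<in> Sigma ?A (\<lambda>S. tableaux n (?D S))"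
      using restrict_tableaux(1)[OF T] column_lengths_shorten_max_columns[OF T \<alpha>] sub by simp
    show "(case (max_columns n (shape w \<alpha>) T, restrict T (?D (max_columns n (shape w \<alpha>) T))) of
        (S, T) \<Rightarrow> monom_of {#n#} ^ card S * weight (?D S) T) = weight (shape w \<alpha>) T"
      using weight_restrict[OF T] by simp
  next
    fix p
    assume "p \<in> Sigma ?A (\<lambda>S. tableaux n (?D S))"
    then obtain S T where p: "p = (S, T)" and "S \<subseteq> {..<w}" "column_lengths w (shorten \<alpha> S)"
      "T \<in> tableaux n (?D S)"
      by auto
    note * = fill_tableaux[OF this(3, 2, 4)]
    show "(case p of (S, T) \<Rightarrow> fill_with n (shape w \<alpha>) (?D S) T) \<in> tableaux (Suc n) (shape w \<alpha>)"
      using *(1) by (simp add: p)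
    show "(max_columns n (shape w \<alpha>) (case p of (S, T) \<Rightarrow> fill_with n (shape w \<alpha>) (?D S) T),
        restrict (case p of (S, T) \<Rightarrow> fill_with n (shape w \<alpha>) (?D S) T)
          (?D (max_columns n (shape w \<alpha>) (case p of (S, T) \<Rightarrow> fill_with n (shape w \<alpha>) (?D S) T)))) = p"
      using *(2, 3) by (simp add: p)
  qed
  also have "\<dots> = (\<Sum>S\<in>?A. monom_of {#n#} ^ card S * schur_poly n (?D S))"
    by (subst sum.Sigma[symmetric]) (simp_all add: fin finite_tableaux schur_poly_def sum_distrib_left)
  finally show ?thesis .
qed

section \<open>The dual Jacobi--Trudi identity\<close>

primrec elem_poly :: "nat \<Rightarrow> int \<Rightarrow> int mfps" where
  "elem_poly 0 m = (if m = 0 then 1 else 0)"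
| "elem_poly (Suc n) m = elem_poly n m + monom_of {#n#} * elem_poly n (m - 1)"

lemma elem_poly_negative: "m < 0 \<Longrightarrow> elem_poly n m = 0"
  by (induction n arbitrary: m) simp_all

lemma jt_elem_poly_Suc:
  "jt (elem_poly (Suc n)) w \<alpha> =
    (\<Sum>S\<in>Pow {..<w}. monom_of {#n#} ^ card S * jt (elem_poly n) w (shorten \<alpha> S))"
proof -
  have "jt (elem_poly (Suc n)) w \<alpha> = det (mat w w (\<lambda>(i, j). elem_poly n (\<alpha> i + int j - int i) +
      monom_of {#n#} * elem_poly n (\<alpha> i + int j - int i - 1)))"
    by (simp add: jt_def)
  also have "\<dots> = (\<Sum>S\<in>Pow {..<w}. monom_of {#n#} ^ card S * jt (elem_poly n) w (shorten \<alpha> S))"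
    unfolding det_add_rows jt_def shorten_def
    by (intro sum.cong refl arg_cong2[where f = "(*)"] arg_cong[where f = det] cong_mat)
       (auto simp: algebra_simps)
  finally show ?thesis .
qed

lemma schur_poly_empty: "schur_poly n {} = 1"
proof -
  have "tableaux n {} = {\<lambda>_. undefined}"
    by (auto simp: tableaux_def)
  then show ?thesis
    by (simp add: schur_poly_def weight_def monom_of_empty)
qed

lemma schur_poly_no_variables: "D \<noteq> {} \<Longrightarrow> schur_poly 0 D = 0"
  by (auto simp: schur_poly_def tableaux_def intro!: sum.neutral)

text \<open>
  Adjoining a variable, both sides satisfy the same recursion: on the left it is the removal of the
  largest entry, on the right the multilinear expansion of the determinant, in which each column is
  either kept or shortened by one. The right-hand sum has more terms, but each additional term either
  shortens a column and not the next one of the same length, or shortens an empty column, and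
  therefore vanishes.
\<close>

theorem schur_poly_eq_jt:
  assumes "column_lengths w \<alpha>"
  shows "schur_poly n (shape w \<alpha>) = jt (elem_poly n) w \<alpha>"
  using assms
proof (induction n arbitrary: \<alpha>)
  case 0
  show ?case
  proof (cases "\<forall>j<w. \<alpha> j = 0")
    case True
    then have "mat w w (\<lambda>(i, j). elem_poly 0 (\<alpha> i + int j - int i)) = 1\<^sub>m w"
      by (intro eq_matI) auto
    moreover have "shape w \<alpha> = {}"
      using True by (auto simp: shape_def)
    ultimately show ?thesis
      by (simp add: jt_def schur_poly_empty)
  next
    case False
    then obtain j where j: "j < w" "\<alpha> j > 0"
      using 0 by (force simp: column_lengths_def)
    have anti: "\<alpha> k \<le> \<alpha> 0" if "k < w" for k
      using that
    proof (induction k)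
      case (Suc k)
      with 0 show ?case
        by (force simp: column_lengths_def)
    qed simp
    from j anti[of j] have "\<alpha> 0 > 0"
      by simp
    moreover from j obtain v where "w = Suc v"
      by (cases w) auto
    ultimately have "jt (elem_poly 0) w \<alpha> = 0"
      by (simp add: jt_def det_expand_first_row del: sum.lessThan_Suc)
    moreover have "shape w \<alpha> \<noteq> {}"
      using j mem_shape[of 0 j w \<alpha>] by auto
    ultimately show ?thesis
      by (simp add: schur_poly_no_variables del: elem_poly.simps)
  qed
next
  case (Suc n)
  \<comment> \<open>Shortenings that do not leave a diagram contribute nothing to the determinant either.\<close>
  have vanish: "jt (elem_poly n) w (shorten \<alpha> S) = 0" if "\<not> column_lengths w (shorten \<alpha> S)" for S
  proof (rule jt_not_column_lengths[OF elem_poly_negative _ that])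
    show "shorten \<alpha> S (Suc j) \<le> shorten \<alpha> S j + 1" if "Suc j < w" for j
    proof -
      have "\<alpha> (Suc j) \<le> \<alpha> j"
        using Suc.prems that by (auto simp: column_lengths_def)
      then show ?thesis
        by (simp add: shorten_def)
    qed
  qed
  have "schur_poly (Suc n) (shape w \<alpha>) = (\<Sum>S | S \<subseteq> {..<w} \<and> column_lengths w (shorten \<alpha> S).
       monom_of {#n#} ^ card S * jt (elem_poly n) w (shorten \<alpha> S))"
    by (subst schur_poly_Suc[OF Suc.prems]) (auto intro!: sum.cong simp: Suc.IH)
  also have "\<dots> = (\<Sum>S\<in>Pow {..<w}. monom_of {#n#} ^ card S * jt (elem_poly n) w (shorten \<alpha> S))"
    by (rule sum.mono_neutral_left) (auto simp: vanish)
  finally show ?case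
    by (simp only: jt_elem_poly_Suc)
qed

definition elementary :: "int \<Rightarrow> int mfps" where
  "elementary m = schur_rep 1 m []"

lemma elementary_negative: "m < 0 \<Longrightarrow> elementary m = 0"
  by (simp add: elementary_def schur_rep_def)

lemma trunc_vars_elementary: "trunc_vars n (elementary m) = elem_poly n m"
proof (cases "m < 0")
  case True
  then show ?thesis
    by (simp add: elementary_negative elem_poly_negative) (simp add: mfps_eqI mcoeff_trunc_vars mcoeff_simps)
next
  case False
  have "is_partition (replicate (nat m) 1)"
    by (auto simp: is_partition_def sorted_wrt_iff_nth_less)
  moreover have "cells (replicate (nat m) 1) = shape 1 (\<lambda>_. m)"
    using False by (auto simp: cells_def shape_def)
  moreover have "column_lengths 1 (\<lambda>_. m)"
    using False by (simp add: column_lengths_def)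
  moreover have "jt e 1 (\<lambda>_. m) = e m" for e :: "int \<Rightarrow> int mfps"
    unfolding jt_def by (subst det_single) auto
  ultimately show ?thesis
    using False by (simp add: elementary_def schur_rep_def trunc_vars_schur schur_poly_eq_jt)
qed

theorem schur_eq_jt:
  assumes "is_partition \<mu>" "cells \<mu> = shape w \<alpha>" "column_lengths w \<alpha>"
  shows "schur \<mu> = jt elementary w \<alpha>"
proof (rule mfps_eq_trunc_varsI)
  fix n
  interpret comm_ring_hom "trunc_vars n"
    by (rule comm_ring_hom_trunc_vars)
  have "map_mat (trunc_vars n) (mat w w (\<lambda>(i, j). elementary (\<alpha> i + int j - int i))) =
      mat w w (\<lambda>(i, j). elem_poly n (\<alpha> i + int j - int i))"
    by (rule eq_matI) (auto simp: trunc_vars_elementary)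
  then have "trunc_vars n (jt elementary w \<alpha>) = jt (elem_poly n) w \<alpha>"
    by (simp add: jt_def hom_det[symmetric])
  then show "trunc_vars n (schur \<mu>) = trunc_vars n (jt elementary w \<alpha>)"
    using assms by (simp add: trunc_vars_schur schur_poly_eq_jt)
qed

lemma less_length_filter_iff:
  assumes "sorted_wrt (\<ge>) (\<mu> :: nat list)"
  shows "i < length (filter (\<lambda>x. j < x) \<mu>) \<longleftrightarrow> i < length \<mu> \<and> j < \<mu> ! i"
  using assms
proof (induction \<mu> arbitrary: i)
  case (Cons a \<mu>)
  show ?case
  proof (cases "j < a")
    case True
    with Cons show ?thesis
      by (cases i) auto
  next
    case False
    with Cons.prems have le: "x \<le> j" if "x \<in> set (a # \<mu>)" for x
      using that by force
    then have "filter (\<lambda>x. j < x) (a # \<mu>) = []"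
      by (force simp: filter_empty_conv)
    with le nth_mem[of i "a # \<mu>"] show ?thesis
      by force
  qed
qed simp

text \<open>
  If \<open>k < 0\<close>, both sides are 0; thus the convention for negative multiplicities is built into
  the determinants.
\<close>

lemma schur_rep_eq_jt:
  assumes \<mu>: "sorted_wrt (\<ge>) \<mu>" "set \<mu> \<subseteq> {0<..v}"
  shows "schur_rep (Suc v) k \<mu> =
    jt elementary (Suc v) (\<lambda>j. k + int (length (filter (\<lambda>x. j < x) \<mu>)))"
    (is "_ = jt elementary (Suc v) ?\<alpha>")
proof (cases "k < 0")
  case True
  have "filter (\<lambda>x. v < x) \<mu> = []"
    using \<mu> by (force simp: filter_empty_conv)
  with True have "?\<alpha> v < 0"
    by simp
  then have "jt elementary (Suc v) ?\<alpha> = 0"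
    using jt_negative_last[of elementary "?\<alpha>" v] elementary_negative by blast
  with True show ?thesis
    by (simp add: schur_rep_def)
next
  case False
  let ?\<nu> = "replicate (nat k) (Suc v) @ \<mu>"
  have "is_partition ?\<nu>"
    using \<mu> by (force simp: is_partition_def sorted_wrt_append sorted_wrt_iff_nth_less[of _ "replicate _ _"])
  moreover have "cells ?\<nu> = shape (Suc v) ?\<alpha>"
  proof (rule Set.set_eqI, clarify)
    fix i j
    have parts: "\<mu> ! n \<le> v" if "n < length \<mu>" for n
      using \<mu>(2) nth_mem[OF that] by auto
    show "(i, j) \<in> cells ?\<nu> \<longleftrightarrow> (i, j) \<in> shape (Suc v) ?\<alpha>"
    proof (cases "i < nat k")
      case True
      then show ?thesis
        by (auto simp: cells_def mem_shape nth_append)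
    next
      case i: False
      have "(i, j) \<in> cells ?\<nu> \<longleftrightarrow> i - nat k < length \<mu> \<and> j < \<mu> ! (i - nat k)"
        using i by (auto simp: cells_def nth_append)
      also have "\<dots> \<longleftrightarrow> j < Suc v \<and> i - nat k < length (filter (\<lambda>x. j < x) \<mu>)"
        using parts[of "i - nat k"] by (auto simp: less_length_filter_iff[OF \<mu>(1)])
      also have "\<dots> \<longleftrightarrow> (i, j) \<in> shape (Suc v) ?\<alpha>"
        using i False by (auto simp: mem_shape)
      finally show ?thesis .
    qed
  qed
  moreover have "column_lengths (Suc v) ?\<alpha>"
  proof -
    have "length (filter (\<lambda>x. Suc j < x) \<mu>) \<le> length (filter (\<lambda>x. j < x) \<mu>)" for j
      by (induction \<mu>) auto
    with False show ?thesis
      by (auto simp: column_lengths_def)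
  qed
  ultimately show ?thesis
    using schur_eq_jt False by (simp add: schur_rep_def)
qed

lemma jt_eq_0_or_schur:
  assumes "\<And>j. Suc j < Suc w \<Longrightarrow> \<alpha> (Suc j) \<le> \<alpha> j + 1"
  shows "jt elementary (Suc w) \<alpha> = 0 \<or> (\<exists>\<mu>. is_partition \<mu> \<and> jt elementary (Suc w) \<alpha> = schur \<mu>)"
proof (cases "column_lengths (Suc w) \<alpha>")
  case False
  then show ?thesis
    using jt_not_column_lengths[of elementary "Suc w" \<alpha>] elementary_negative assms by blast
next
  case True
  have anti: "\<alpha> k \<le> \<alpha> j" if "j \<le> k" "k < Suc w" for j k
    using that
  proof (induction k rule: dec_induct)
    case (step k)
    with True show ?case
      by (force simp: column_lengths_def)
  qed simp
  define row where "row i = card {j. j < Suc w \<and> int i < \<alpha> j}" for i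
  have row: "j < row i \<longleftrightarrow> j < Suc w \<and> int i < \<alpha> j" for i j
  proof -
    have *: "{..j} \<subseteq> {j. j < Suc w \<and> int i < \<alpha> j}" if "j < Suc w" "int i < \<alpha> j"
    proof
      fix m
      assume "m \<in> {..j}"
      with that anti[of m j] show "m \<in> {j. j < Suc w \<and> int i < \<alpha> j}"
        by auto
    qed
    have **: "{j. j < Suc w \<and> int i < \<alpha> j} \<subseteq> {..<j}" if "\<not> (j < Suc w \<and> int i < \<alpha> j)"
    proof
      fix m
      assume "m \<in> {j. j < Suc w \<and> int i < \<alpha> j}"
      with that anti[of j m] show "m \<in> {..<j}"
        by (cases "j \<le> m") auto
    qed
    show ?thesis
      using card_mono[OF _ *] card_mono[OF _ **] by (cases "j < Suc w \<and> int i < \<alpha> j") (auto simp: row_def)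
  qed
  define \<mu> where "\<mu> = map row [0..<nat (\<alpha> 0)]"
  have "is_partition \<mu>"
  proof -
    have "row k \<le> row i" if "i \<le> k" for i k
      unfolding row_def using that by (intro card_mono) auto
    moreover have "0 < row i" if "i < nat (\<alpha> 0)" for i
      using row[of 0 i] that by simp
    ultimately show ?thesis
      by (auto simp: is_partition_def \<mu>_def sorted_wrt_iff_nth_less) fastforce
  qed
  moreover have "cells \<mu> = shape (Suc w) \<alpha>"
  proof (rule Set.set_eqI, clarify)
    fix i j
    show "(i, j) \<in> cells \<mu> \<longleftrightarrow> (i, j) \<in> shape (Suc w) \<alpha>"
      using anti[of 0 j] row[of j i] by (auto simp: cells_def mem_shape \<mu>_def)
  qed
  ultimately show ?thesis
    using schur_eq_jt True by auto
qed

section \<open>Summation over the outer pair of columns\<close>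

lemma sum_telescope_int:
  fixes g :: "int \<Rightarrow> 'a :: ab_group_add"
  assumes "p \<le> r + 1"
  shows "(\<Sum>a\<in>{p..r}. g a - g (a + 1)) = g p - g (r + 1)"
proof -
  have "p - 1 \<le> r"
    using assms by simp
  then show ?thesis
  proof (induction r rule: int_ge_induct)
    case (step r)
    then have "{p..r + 1} = insert (r + 1) {p..r}"
      by auto
    with step show ?case
      by simp
  qed simp_all
qed

text \<open>
  An antisymmetric sum whose interior cancels: only products with indices near \<open>p\<close> and \<open>c - p\<close>
  survive, however long the range of \<open>a\<close> is.
\<close>

lemma telescope_antisymmetric:
  fixes e :: "int \<Rightarrow> 'a :: comm_ring_1"
  assumes neg: "\<And>m. m < 0 \<Longrightarrow> e m = 0" and p: "p \<le> r + 1" and ij: "i < j" and c: "c + int j \<le> r"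
  shows "(\<Sum>a\<in>{p..r}. e (a + int i) * e (c - a + int j) - e (a + int j) * e (c - a + int i))
    = (\<Sum>t<j - i. e (p + int (i + t)) * e (c - p + int j - int t))"
proof -
  define g where "g a = (\<Sum>t<j - i. e (a + int (i + t)) * e (c - a + int j - int t))" for a
  \<comment> \<open>The two products are the first and the last term of a telescoping sum over the ways
    to shift the index from one factor to the other.\<close>
  have "e (a + int i) * e (c - a + int j) - e (a + int j) * e (c - a + int i) = g a - g (a + 1)" for a
    using ij sum_lessThan_telescope'[of "\<lambda>t. e (a + int (i + t)) * e (c - a + int j - int t)" "j - i"]
    by (simp add: g_def sum_subtractf[symmetric] algebra_simps of_nat_diff)
  \<comment> \<open>Beyond \<open>r\<close> the second factor has a negative index.\<close>
  moreover have "g (r + 1) = 0"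
    unfolding g_def using c by (intro sum.neutral ballI) (simp add: neg)
  ultimately show ?thesis
    using sum_telescope_int[OF p, of g] by (simp add: g_def)
qed

definition antidiagonal_sum :: "(nat \<Rightarrow> 'a :: comm_ring_1) \<Rightarrow> (nat \<Rightarrow> 'a) \<Rightarrow> nat \<Rightarrow> 'a" where
  "antidiagonal_sum x y d = (\<Sum>t<d. x t * y (d - Suc t))"

lemma antidiagonal_sum_numeral:
  "antidiagonal_sum x y 1 = x 0 * y 0"
  "antidiagonal_sum x y 2 = x 0 * y 1 + x 1 * y 0"
  "antidiagonal_sum x y 3 = x 0 * y 2 + x 1 * y 1 + x 2 * y 0"
  "antidiagonal_sum x y 4 = x 0 * y 3 + x 1 * y 2 + x 2 * y 1 + x 3 * y 0"
  "antidiagonal_sum x y 5 = x 0 * y 4 + x 1 * y 3 + x 2 * y 2 + x 3 * y 1 + x 4 * y 0"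
  by (simp_all add: antidiagonal_sum_def numeral_eq_Suc)

text \<open>
  The 3 by 3 determinant with the rows \<open>P\<^sub>a, P\<^bsub>a+1\<^esub>, P\<^bsub>a+2\<^esub>\<close> and likewise for \<open>b\<close>, \<open>c\<close>.
\<close>

definition minor_3 :: "(nat \<Rightarrow> 'a :: comm_ring_1) \<Rightarrow> nat \<Rightarrow> nat \<Rightarrow> nat \<Rightarrow> 'a" where
  "minor_3 P a b c =
    P a * (P (b + 1) * P (c + 2) - P (b + 2) * P (c + 1))
  - P (a + 1) * (P b * P (c + 2) - P (b + 2) * P c)
  + P (a + 2) * (P b * P (c + 1) - P (b + 1) * P c)"

lemma jt_3:
  assumes "x = b + int i" "y = b + int j + 1" "z = b + int k + 2"
  shows "jt e 3 ((!) [x, y, z]) = minor_3 (\<lambda>n. e (b + int n)) i j k"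
  using assms by (simp add: jt_def det_mat_3 minor_3_def add_ac)

lemma det_4_rows:
  fixes A B C D :: "nat \<Rightarrow> 'a :: comm_ring_1"
  shows "det (mat 4 4 (\<lambda>(s, k). ([A, B, C, D] ! s) (c k))) =
      (A (c 0) * B (c 1) - A (c 1) * B (c 0)) * (C (c 2) * D (c 3) - C (c 3) * D (c 2))
    - (A (c 0) * B (c 2) - A (c 2) * B (c 0)) * (C (c 1) * D (c 3) - C (c 3) * D (c 1))
    + (A (c 0) * B (c 3) - A (c 3) * B (c 0)) * (C (c 1) * D (c 2) - C (c 2) * D (c 1))
    + (A (c 1) * B (c 2) - A (c 2) * B (c 1)) * (C (c 0) * D (c 3) - C (c 3) * D (c 0))
    - (A (c 1) * B (c 3) - A (c 3) * B (c 1)) * (C (c 0) * D (c 2) - C (c 2) * D (c 0))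
    + (A (c 2) * B (c 3) - A (c 3) * B (c 2)) * (C (c 0) * D (c 1) - C (c 1) * D (c 0))"
  by (subst det_mat_4) simp

text \<open>
  The minor complementary to the columns \<open>i < j\<close> in the rows of the lengths \<open>p, p, q, q\<close>, where
  \<open>P\<^sub>n = e\<^bsub>p-2+n\<^esub>\<close> and \<open>Q\<^sub>n = e\<^bsub>q-5+n\<^esub>\<close>; the offsets 2 and 5 make all indices
  that occur natural numbers.
\<close>

definition middle_minor :: "(nat \<Rightarrow> 'a :: comm_ring_1) \<Rightarrow> (nat \<Rightarrow> 'a) \<Rightarrow> nat \<Rightarrow> nat \<Rightarrow> 'a" where
  "middle_minor P Q i j = det (mat 4 4 (\<lambda>(s, k).
     ([\<lambda>k. P (k + 1), P, \<lambda>k. Q (k + 2), \<lambda>k. Q (k + 1)] ! s) (skip j (skip i k))))"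

lemma sum_jt_6:
  fixes e :: "int \<Rightarrow> 'a :: comm_ring_1"
  assumes neg: "\<And>m. m < 0 \<Longrightarrow> e m = 0" and p: "p \<le> r + 1" and r: "r = p + q + 1" and m: "m \<le> 2"
  shows "(\<Sum>a\<in>{p..r}. jt e 6 ((!) [a, p, p, q, q, r - int m - a])) =
    (\<Sum>j<6. \<Sum>i<j. (-1) ^ (i + j + 1) *
      (antidiagonal_sum (\<lambda>t. e (p - 2 + int (2 + i + t))) (\<lambda>s. e (q - 5 + int (2 - m + i + s))) (j - i) *
       middle_minor (\<lambda>n. e (p - 2 + int n)) (\<lambda>n. e (q - 5 + int n)) i j))"
  (is "_ = (\<Sum>j<6. \<Sum>i<j. ?s i j * (?c i j * ?K i j))")
proof -
  let ?d = "\<lambda>i j a. e (a + int i) * e (r - int m - 5 - a + int j)"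
  have "jt e 6 ((!) [a, p, p, q, q, r - int m - a]) =
     (\<Sum>j<6. \<Sum>i<j. ?s i j * ((?d i j a - ?d j i a) * ?K i j))" for a
    unfolding jt_def middle_minor_def mult.assoc[symmetric]
  proof (subst det_6_outer_rows[symmetric], intro arg_cong[where f = det] cong_mat refl, unfold prod.case)
    fix i j :: nat
    assume "i < 6"
    then consider "i = 0" | "i = 1" | "i = 2" | "i = 3" | "i = 4" | "i = 5"
      by linarith
    then show "e ([a, p, p, q, q, r - int m - a] ! i + int j - int i) =
      (if i = 0 then e (a + int j) else if i = 5 then e (r - int m - 5 - a + int j)
       else ([\<lambda>k. e (p - 2 + int (k + 1)), \<lambda>n. e (p - 2 + int n), \<lambda>k. e (q - 5 + int (k + 2)),
         \<lambda>k. e (q - 5 + int (k + 1))] ! (i - 1)) j)"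
      by cases (simp_all add: algebra_simps)
  qed
  then have "(\<Sum>a\<in>{p..r}. jt e 6 ((!) [a, p, p, q, q, r - int m - a])) =
     (\<Sum>a\<in>{p..r}. \<Sum>j<6. \<Sum>i<j. ?s i j * ((?d i j a - ?d j i a) * ?K i j))"
    by simp
  also have "\<dots> = (\<Sum>j<6. \<Sum>a\<in>{p..r}. \<Sum>i<j. ?s i j * ((?d i j a - ?d j i a) * ?K i j))"
    by (rule sum.swap)
  also have "\<dots> = (\<Sum>j<6. \<Sum>i<j. \<Sum>a\<in>{p..r}. ?s i j * ((?d i j a - ?d j i a) * ?K i j))"
    by (intro sum.cong refl sum.swap)
  also have "\<dots> = (\<Sum>j<6. \<Sum>i<j. ?s i j * ((\<Sum>a\<in>{p..r}. ?d i j a - ?d j i a) * ?K i j))"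
    by (simp only: sum_distrib_left sum_distrib_right)
  also have "\<dots> = (\<Sum>j<6. \<Sum>i<j. ?s i j * (?c i j * ?K i j))"
  proof (intro sum.cong refl arg_cong2[where f = "(*)"])
    fix i j :: nat
    assume "j \<in> {..<6}" "i \<in> {..<j}"
    then have "(\<Sum>a\<in>{p..r}. ?d i j a - ?d j i a) =
        (\<Sum>t<j - i. e (p + int (i + t)) * e (r - int m - 5 - p + int j - int t))"
      by (intro telescope_antisymmetric neg p) auto
    also have "\<dots> = ?c i j"
      unfolding antidiagonal_sum_def using m \<open>i \<in> {..<j}\<close>
      by (intro sum.cong refl arg_cong2[where f = "(*)"] arg_cong[where f = e])
         (auto simp: r of_nat_diff)
    finally show "(\<Sum>a\<in>{p..r}. ?d i j a - ?d j i a) = ?c i j" .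
  qed
  finally show ?thesis .
qed

lemma alternating_sum_pairs_6:
  fixes f :: "nat \<Rightarrow> nat \<Rightarrow> nat \<Rightarrow> 'a :: comm_ring_1"
  shows "(\<Sum>j<6. \<Sum>i<j. (-1) ^ (i + j + 1) * f i j (j - i)) =
     f 0 1 1 + (f 1 2 1 - f 0 2 2) + (f 0 3 3 - f 1 3 2 + f 2 3 1)
   + (f 1 4 3 - f 0 4 4 - f 2 4 2 + f 3 4 1)
   + (f 0 5 5 - f 1 5 4 + f 2 5 3 - f 3 5 2 + f 4 5 1)"
  by (simp add: numeral_eq_Suc)

lemmas eval_index = arith_simps rel_simps if_True if_False Suc_eq_plus1 zero_less_one
  not_one_less_zero simp_thms numeral_One one_add_one one_plus_numeral numeral_plus_one
  less_irrefl add_num_simps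

text \<open>
  The next three identities hold for independent variables \<open>P\<^sub>n\<close>, \<open>Q\<^sub>n\<close> and are verified by
  expansion into monomials. Their right-hand sides come from ordering the monomials by dominance: the
  diagonal term of a product of two 3 by 3 determinants is minimal among its terms, so
  the products can be read off and subtracted one by one.
\<close>

lemma outer_pair_expansion_0:
  fixes P Q :: "nat \<Rightarrow> 'a :: comm_ring_1"
  shows "(\<Sum>j<6. \<Sum>i<j. (-1) ^ (i + j + 1) *
      (antidiagonal_sum (\<lambda>t. P (2 + i + t)) (\<lambda>s. Q (2 + i + s)) (j - i) * middle_minor P Q i j)) =
     minor_3 P 3 1 0 * minor_3 Q 5 4 3
   - minor_3 P 3 2 0 * minor_3 Q 5 4 2
   + minor_3 P 3 2 1 * minor_3 Q 5 4 1
   + minor_3 P 4 3 0 * minor_3 Q 4 3 2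
   - minor_3 P 4 3 1 * minor_3 Q 4 3 1
   + minor_3 P 4 3 2 * minor_3 Q 4 2 1"
  by (subst alternating_sum_pairs_6,
      simp only: middle_minor_def det_4_rows antidiagonal_sum_numeral skip_def minor_3_def eval_index,
      simp only: algebra_simps)

lemma outer_pair_expansion_1:
  fixes P Q :: "nat \<Rightarrow> 'a :: comm_ring_1"
  shows "(\<Sum>j<6. \<Sum>i<j. (-1) ^ (i + j + 1) *
      (antidiagonal_sum (\<lambda>t. P (2 + i + t)) (\<lambda>s. Q (1 + i + s)) (j - i) * middle_minor P Q i j)) =
     minor_3 P 2 1 0 * minor_3 Q 5 4 3
   - minor_3 P 3 2 0 * minor_3 Q 5 3 2
   + minor_3 P 3 2 1 * minor_3 Q 5 3 1
   + minor_3 P 4 2 0 * minor_3 Q 4 3 2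
   - minor_3 P 4 2 1 * minor_3 Q 4 3 1
   + minor_3 P 4 3 2 * minor_3 Q 3 2 1"
  by (subst alternating_sum_pairs_6,
      simp only: middle_minor_def det_4_rows antidiagonal_sum_numeral skip_def minor_3_def eval_index,
      simp only: algebra_simps)

lemma outer_pair_expansion_2:
  fixes P Q :: "nat \<Rightarrow> 'a :: comm_ring_1"
  shows "(\<Sum>j<6. \<Sum>i<j. (-1) ^ (i + j + 1) *
      (antidiagonal_sum (\<lambda>t. P (2 + i + t)) (\<lambda>s. Q (0 + i + s)) (j - i) * middle_minor P Q i j)) =
     minor_3 P 2 1 0 * minor_3 Q 5 4 2
   - minor_3 P 3 1 0 * minor_3 Q 5 3 2
   + minor_3 P 3 2 1 * minor_3 Q 5 2 1
   + minor_3 P 4 1 0 * minor_3 Q 4 3 2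
   - minor_3 P 4 2 1 * minor_3 Q 4 2 1
   + minor_3 P 4 3 1 * minor_3 Q 3 2 1"
  by (subst alternating_sum_pairs_6,
      simp only: middle_minor_def det_4_rows antidiagonal_sum_numeral skip_def minor_3_def eval_index,
      simp only: algebra_simps)

lemma sum_jt_6_eq_minors_0:
  fixes e :: "int \<Rightarrow> 'a :: comm_ring_1"
  assumes neg: "\<And>m. m < 0 \<Longrightarrow> e m = 0" and p: "p \<le> r + 1" and r: "r = p + q + 1"
  shows "(\<Sum>a\<in>{p..r}. jt e 6 ((!) [a, p, p, q, q, r - 0 - a])) =
     jt e 3 ((!) [p + 1, p, p]) * jt e 3 ((!) [q, q, q])
   - jt e 3 ((!) [p + 1, p + 1, p]) * jt e 3 ((!) [q, q, q - 1])
   + jt e 3 ((!) [p + 1, p + 1, p + 1]) * jt e 3 ((!) [q, q, q - 2])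
   + jt e 3 ((!) [p + 2, p + 2, p]) * jt e 3 ((!) [q - 1, q - 1, q - 1])
   - jt e 3 ((!) [p + 2, p + 2, p + 1]) * jt e 3 ((!) [q - 1, q - 1, q - 2])
   + jt e 3 ((!) [p + 2, p + 2, p + 2]) * jt e 3 ((!) [q - 1, q - 2, q - 2])"
proof -
  let ?P = "\<lambda>n. e (p - 2 + int n)" and ?Q = "\<lambda>n. e (q - 5 + int n)"
  have "jt e 3 ((!) [p + 1, p, p]) = minor_3 ?P 3 1 0"
    "jt e 3 ((!) [q, q, q]) = minor_3 ?Q 5 4 3"
    "jt e 3 ((!) [p + 1, p + 1, p]) = minor_3 ?P 3 2 0"
    "jt e 3 ((!) [q, q, q - 1]) = minor_3 ?Q 5 4 2"
    "jt e 3 ((!) [p + 1, p + 1, p + 1]) = minor_3 ?P 3 2 1"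
    "jt e 3 ((!) [q, q, q - 2]) = minor_3 ?Q 5 4 1"
    "jt e 3 ((!) [p + 2, p + 2, p]) = minor_3 ?P 4 3 0"
    "jt e 3 ((!) [q - 1, q - 1, q - 1]) = minor_3 ?Q 4 3 2"
    "jt e 3 ((!) [p + 2, p + 2, p + 1]) = minor_3 ?P 4 3 1"
    "jt e 3 ((!) [q - 1, q - 1, q - 2]) = minor_3 ?Q 4 3 1"
    "jt e 3 ((!) [p + 2, p + 2, p + 2]) = minor_3 ?P 4 3 2"
    "jt e 3 ((!) [q - 1, q - 2, q - 2]) = minor_3 ?Q 4 2 1"
    by (rule jt_3; simp)+
  then show ?thesis
    using sum_jt_6[OF neg p r, where m = 0] outer_pair_expansion_0[of ?P ?Q] by simp
qed

lemma sum_jt_6_eq_minors_1: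
  fixes e :: "int \<Rightarrow> 'a :: comm_ring_1"
  assumes neg: "\<And>m. m < 0 \<Longrightarrow> e m = 0" and p: "p \<le> r + 1" and r: "r = p + q + 1"
  shows "(\<Sum>a\<in>{p..r}. jt e 6 ((!) [a, p, p, q, q, r - 1 - a])) =
     jt e 3 ((!) [p, p, p]) * jt e 3 ((!) [q, q, q])
   - jt e 3 ((!) [p + 1, p + 1, p]) * jt e 3 ((!) [q, q - 1, q - 1])
   + jt e 3 ((!) [p + 1, p + 1, p + 1]) * jt e 3 ((!) [q, q - 1, q - 2])
   + jt e 3 ((!) [p + 2, p + 1, p]) * jt e 3 ((!) [q - 1, q - 1, q - 1])
   - jt e 3 ((!) [p + 2, p + 1, p + 1]) * jt e 3 ((!) [q - 1, q - 1, q - 2])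
   + jt e 3 ((!) [p + 2, p + 2, p + 2]) * jt e 3 ((!) [q - 2, q - 2, q - 2])"
proof -
  let ?P = "\<lambda>n. e (p - 2 + int n)" and ?Q = "\<lambda>n. e (q - 5 + int n)"
  have "jt e 3 ((!) [p, p, p]) = minor_3 ?P 2 1 0"
    "jt e 3 ((!) [q, q, q]) = minor_3 ?Q 5 4 3"
    "jt e 3 ((!) [p + 1, p + 1, p]) = minor_3 ?P 3 2 0"
    "jt e 3 ((!) [q, q - 1, q - 1]) = minor_3 ?Q 5 3 2"
    "jt e 3 ((!) [p + 1, p + 1, p + 1]) = minor_3 ?P 3 2 1"
    "jt e 3 ((!) [q, q - 1, q - 2]) = minor_3 ?Q 5 3 1"
    "jt e 3 ((!) [p + 2, p + 1, p]) = minor_3 ?P 4 2 0"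
    "jt e 3 ((!) [q - 1, q - 1, q - 1]) = minor_3 ?Q 4 3 2"
    "jt e 3 ((!) [p + 2, p + 1, p + 1]) = minor_3 ?P 4 2 1"
    "jt e 3 ((!) [q - 1, q - 1, q - 2]) = minor_3 ?Q 4 3 1"
    "jt e 3 ((!) [p + 2, p + 2, p + 2]) = minor_3 ?P 4 3 2"
    "jt e 3 ((!) [q - 2, q - 2, q - 2]) = minor_3 ?Q 3 2 1"
    by (rule jt_3; simp)+
  then show ?thesis
    using sum_jt_6[OF neg p r, where m = 1] outer_pair_expansion_1[of ?P ?Q] by simp
qed

lemma sum_jt_6_eq_minors_2:
  fixes e :: "int \<Rightarrow> 'a :: comm_ring_1"
  assumes neg: "\<And>m. m < 0 \<Longrightarrow> e m = 0" and p: "p \<le> r + 1" and r: "r = p + q + 1"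
  shows "(\<Sum>a\<in>{p..r}. jt e 6 ((!) [a, p, p, q, q, r - 2 - a])) =
     jt e 3 ((!) [p, p, p]) * jt e 3 ((!) [q, q, q - 1])
   - jt e 3 ((!) [p + 1, p, p]) * jt e 3 ((!) [q, q - 1, q - 1])
   + jt e 3 ((!) [p + 1, p + 1, p + 1]) * jt e 3 ((!) [q, q - 2, q - 2])
   + jt e 3 ((!) [p + 2, p, p]) * jt e 3 ((!) [q - 1, q - 1, q - 1])
   - jt e 3 ((!) [p + 2, p + 1, p + 1]) * jt e 3 ((!) [q - 1, q - 2, q - 2])
   + jt e 3 ((!) [p + 2, p + 2, p + 1]) * jt e 3 ((!) [q - 2, q - 2, q - 2])"
proof -
  let ?P = "\<lambda>n. e (p - 2 + int n)" and ?Q = "\<lambda>n. e (q - 5 + int n)"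
  have "jt e 3 ((!) [p, p, p]) = minor_3 ?P 2 1 0"
    "jt e 3 ((!) [q, q, q - 1]) = minor_3 ?Q 5 4 2"
    "jt e 3 ((!) [p + 1, p, p]) = minor_3 ?P 3 1 0"
    "jt e 3 ((!) [q, q - 1, q - 1]) = minor_3 ?Q 5 3 2"
    "jt e 3 ((!) [p + 1, p + 1, p + 1]) = minor_3 ?P 3 2 1"
    "jt e 3 ((!) [q, q - 2, q - 2]) = minor_3 ?Q 5 2 1"
    "jt e 3 ((!) [p + 2, p, p]) = minor_3 ?P 4 1 0"
    "jt e 3 ((!) [q - 1, q - 1, q - 1]) = minor_3 ?Q 4 3 2"
    "jt e 3 ((!) [p + 2, p + 1, p + 1]) = minor_3 ?P 4 2 1"
    "jt e 3 ((!) [q - 1, q - 2, q - 2]) = minor_3 ?Q 4 2 1"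
    "jt e 3 ((!) [p + 2, p + 2, p + 1]) = minor_3 ?P 4 3 1"
    "jt e 3 ((!) [q - 2, q - 2, q - 2]) = minor_3 ?Q 3 2 1"
    by (rule jt_3; simp)+
  then show ?thesis
    using sum_jt_6[OF neg p r, where m = 2] outer_pair_expansion_2[of ?P ?Q] by simp
qed

section \<open>Schur positivity\<close>

lemma schur_positive_0: "schur_positive 0"
  unfolding schur_positive_def schur_expansion_def by (intro exI[of _ "\<lambda>_. 0"]) simp

lemma schur_positive_schur:
  assumes "is_partition \<mu>"
  shows "schur_positive (schur \<mu>)"
proof -
  have "{\<nu>. (if \<nu> = \<mu> then 1 else 0 :: int) \<noteq> 0} = {\<mu>}"
    by auto
  with assms show ?thesis
    unfolding schur_positive_def schur_expansion_def
    by (intro exI[of _ "\<lambda>\<nu>. if \<nu> = \<mu> then 1 else 0"]) auto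
qed

lemma schur_positive_add:
  assumes "schur_positive f" "schur_positive g"
  shows "schur_positive (f + g)"
proof -
  obtain a b where a: "schur_expansion f a" "\<And>\<mu>. a \<mu> \<ge> 0" and b: "schur_expansion g b" "\<And>\<mu>. b \<mu> \<ge> 0"
    using assms by (auto simp: schur_positive_def)
  let ?A = "{\<mu>. a \<mu> \<noteq> 0}" and ?B = "{\<mu>. b \<mu> \<noteq> 0}" and ?C = "{\<mu>. a \<mu> + b \<mu> \<noteq> 0}"
  have fin: "finite ?A" "finite ?B" "finite (?A \<union> ?B)" and C: "?C \<subseteq> ?A \<union> ?B"
    using a b by (auto simp: schur_expansion_def)
  have "f = (\<Sum>\<mu>\<in>?A \<union> ?B. of_int (a \<mu>) * schur \<mu>)"
    using a(1) fin by (auto simp: schur_expansion_def intro!: sum.mono_neutral_left)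
  moreover have "g = (\<Sum>\<mu>\<in>?A \<union> ?B. of_int (b \<mu>) * schur \<mu>)"
    using b(1) fin by (auto simp: schur_expansion_def intro!: sum.mono_neutral_left)
  moreover have "(\<Sum>\<mu>\<in>?C. of_int (a \<mu> + b \<mu>) * schur \<mu>) =
      (\<Sum>\<mu>\<in>?A \<union> ?B. of_int (a \<mu> + b \<mu>) * schur \<mu>)"
    using fin C by (intro sum.mono_neutral_left) auto
  ultimately have "f + g = (\<Sum>\<mu>\<in>?C. of_int (a \<mu> + b \<mu>) * schur \<mu>)"
    by (simp add: sum.distrib distrib_right)
  moreover have "is_partition \<mu>" if "a \<mu> + b \<mu> \<noteq> 0" for \<mu>
    using that a(1) b(1) by (cases "a \<mu> = 0") (auto simp: schur_expansion_def)
  ultimately have "schur_expansion (f + g) (\<lambda>\<mu>. a \<mu> + b \<mu>)"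
    using finite_subset[OF C fin(3)] by (simp add: schur_expansion_def)
  then show ?thesis
    using a(2) b(2) by (auto simp: schur_positive_def intro!: exI[of _ "\<lambda>\<mu>. a \<mu> + b \<mu>"])
qed

lemma schur_positive_sum:
  "(\<And>x. x \<in> A \<Longrightarrow> schur_positive (f x)) \<Longrightarrow> schur_positive (\<Sum>x\<in>A. f x)"
  by (induction A rule: infinite_finite_induct) (auto simp: schur_positive_0 schur_positive_add)

lemma mfps_double_cancel:
  assumes "f + f = g + (g :: int mfps)"
  shows "f = g"
proof (rule mfps_eqI)
  fix M
  have "mcoeff (f + f) M = mcoeff (g + g) M"
    by (simp only: assms)
  then show "mcoeff f M = mcoeff g M"
    unfolding mcoeff_simps by simp
qed

section \<open>The sum over all rectangles\<close>

definition col3 :: "int \<Rightarrow> int \<Rightarrow> int \<Rightarrow> int mfps" where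
  "col3 a b c = jt elementary 3 ((!) [a, b, c])"

lemma col3_negative: "c < 0 \<Longrightarrow> col3 a b c = 0"
  unfolding col3_def using jt_negative_last[OF elementary_negative, where \<alpha> = "(!) [a, b, c]" and w = 2]
  by (simp add: numeral_eq_Suc)

lemma schur_rep_3_eq_col3:
  "schur_rep 3 (k - 2) [2, 2] = col3 k k (k - 2)"
  "schur_rep 3 (k - 2) [2, 1] = col3 k (k - 1) (k - 2)"
  "schur_rep 3 (k - 1) [1] = col3 k (k - 1) (k - 1)"
  "schur_rep 3 (k - 2) [1, 1] = col3 k (k - 2) (k - 2)"
  "schur_rep 3 k [] = col3 k k k"
  "schur_rep 3 (k - 2) [2] = col3 (k - 1) (k - 1) (k - 2)"
  "schur_rep 3 (k - 1) [2] = col3 k k (k - 1)"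
  unfolding col3_def numeral_3_eq_3
  by (subst schur_rep_eq_jt; force simp: less_Suc_eq intro!: jt_cong)+

definition paired_sum :: "int \<Rightarrow> int \<Rightarrow> int \<Rightarrow> int mfps" where
  "paired_sum r p m = (\<Sum>a\<in>{p..r}. jt elementary 6 ((!) [a, p, p, r - 1 - p, r - 1 - p, r - m - a]))"

text \<open>
  With \<open>R\<^sub>k = s\<^bsub>(3\<^sup>k)\<^esub>\<close> and \<open>A\<close> the sum of the operators \<open>D\<^sub>1\<close>, \<open>D\<^sub>2\<close> adjoint to multiplication by \<open>s\<^sub>1\<close>
  and \<open>s\<^sub>2\<close>, the definition of \<open>schur_F\<close> reads
  \<open>F(r,k) = (A\<^sup>2 R\<^sub>k) R\<^bsub>r-k\<^esub> - (A R\<^sub>k) (A R\<^bsub>r-k\<^esub>)\<close>. The weights 1, 2, 1 below are the coefficients of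
  \<open>A\<^sup>2 = D\<^sub>1\<^sup>2 + 2 D\<^sub>1 D\<^sub>2 + D\<^sub>2\<^sup>2\<close>.
\<close>

definition paired_total :: "int \<Rightarrow> int \<Rightarrow> int mfps" where
  "paired_total r p = paired_sum r p 0 + 2 * paired_sum r p 1 + paired_sum r p 2"

text \<open>
  The six-term formulas, weighted by 1, 2, 1, consist of products that belong to the splittings
  \<open>(k, l)\<close> of \<open>r\<close> with \<open>k = p, p + 1, p + 2, p + 3\<close>. The first two groups are the following ones, and the
  last two are the same with \<open>k\<close> and \<open>l\<close> exchanged.
\<close>

definition products_0 where
  "products_0 k l = col3 k k k * col3 (l - 1) (l - 1) (l - 2)"

definition products_1 where
  "products_1 k l =
     col3 k (k - 1) (k - 1) * col3 l l l - col3 k k (k - 1) * col3 l l (l - 1) + col3 k k k * col3 l l (l - 2)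
   + 2 * (col3 (k - 1) (k - 1) (k - 1) * col3 l l l - col3 k k (k - 1) * col3 l (l - 1) (l - 1)
     + col3 k k k * col3 l (l - 1) (l - 2))
   - col3 k (k - 1) (k - 1) * col3 l (l - 1) (l - 1) + col3 k k k * col3 l (l - 2) (l - 2)"

lemma paired_total_eq:
  assumes "p \<le> r + 1"
  shows "paired_total r p =
    products_0 p (r - p) + products_1 (p + 1) (r - (p + 1))
    + products_1 (r - (p + 2)) (p + 2) + products_0 (r - (p + 3)) (p + 3)"
proof -
  define q where "q = r - 1 - p"
  then have r: "r = p + q + 1" and l: "r - p = q + 1" "r - (p + 1) = q"
    "r - (p + 2) = q - 1" "r - (p + 3) = q - 2"
    by simp_all
  show ?thesis
    unfolding paired_total_def paired_sum_def products_0_def products_1_def l q_def[symmetric]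
    using sum_jt_6_eq_minors_0[OF elementary_negative assms r]
      sum_jt_6_eq_minors_1[OF elementary_negative assms r]
      sum_jt_6_eq_minors_2[OF elementary_negative assms r]
    by (simp add: col3_def[symmetric]) (simp add: algebra_simps)
qed

lemma schur_F_symmetrised:
  "schur_F r k + schur_F r (r - k) =
    products_0 k (r - k) + products_1 k (r - k) + products_1 (r - k) k + products_0 (r - k) k"
  unfolding schur_F_def schur_rep_3_eq_col3 products_0_def products_1_def
    schur_rep_3_eq_col3(3, 7)[of "r - k"]
  by (simp add: schur_rep_3_eq_col3 algebra_simps)

lemma sum_shift:
  fixes h :: "int \<Rightarrow> int mfps"
  assumes "\<And>k. k < 0 \<or> r < k \<Longrightarrow> h k = 0" "0 \<le> s" "s \<le> 3"
  shows "(\<Sum>p\<in>{-3..r}. h (p + s)) = (\<Sum>k\<in>{0..r}. h k)"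
proof -
  have "(\<Sum>p\<in>{-3..r}. h (p + s)) = (\<Sum>k\<in>{s - 3..r + s}. h k)"
    by (rule sum.reindex_bij_witness[where i = "\<lambda>k. k - s" and j = "\<lambda>p. p + s"]) auto
  also have "\<dots> = (\<Sum>k\<in>{0..r}. h k)"
    using assms by (intro sum.mono_neutral_right) auto
  finally show ?thesis .
qed

lemma products_outside:
  assumes "k < 0 \<or> l < 0"
  shows "products_0 k l = 0" "products_1 k l = 0"
  using assms by (auto simp: products_0_def products_1_def col3_negative)

lemma sum_paired_total:
  "(\<Sum>p\<in>{-3..r}. paired_total r p) =
    (\<Sum>k\<in>{0..r}. schur_F r k) + (\<Sum>k\<in>{0..r}. schur_F r k)"
proof -
  have "(\<Sum>p\<in>{-3..r}. paired_total r p) = (\<Sum>p\<in>{-3..r}. products_0 (p + 0) (r - (p + 0)))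
      + (\<Sum>p\<in>{-3..r}. products_1 (p + 1) (r - (p + 1)))
      + (\<Sum>p\<in>{-3..r}. products_1 (r - (p + 2)) (p + 2)) + (\<Sum>p\<in>{-3..r}. products_0 (r - (p + 3)) (p + 3))"
    unfolding sum.distrib[symmetric] by (intro sum.cong refl) (simp add: paired_total_eq)
  \<comment> \<open>The range of \<open>p\<close> is chosen such that each of the four shifts of it covers \<open>{0..r}\<close>.\<close>
  also have "\<dots> = (\<Sum>k\<in>{0..r}. products_0 k (r - k)) + (\<Sum>k\<in>{0..r}. products_1 k (r - k))
      + (\<Sum>k\<in>{0..r}. products_1 (r - k) k) + (\<Sum>k\<in>{0..r}. products_0 (r - k) k)"
    by (intro arg_cong2[where f = "(+)"] sum_shift[where h = "\<lambda>k. products_0 k (r - k)"]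
        sum_shift[where h = "\<lambda>k. products_1 k (r - k)"]
        sum_shift[where h = "\<lambda>k. products_1 (r - k) k"]
        sum_shift[where h = "\<lambda>k. products_0 (r - k) k"])
       (auto intro: products_outside)
  also have "\<dots> = (\<Sum>k\<in>{0..r}. schur_F r k + schur_F r (r - k))"
    by (simp add: schur_F_symmetrised sum.distrib)
  also have "\<dots> = (\<Sum>k\<in>{0..r}. schur_F r k) + (\<Sum>k\<in>{0..r}. schur_F r (r - k))"
    by (rule sum.distrib)
  also have "(\<Sum>k\<in>{0..r}. schur_F r (r - k)) = (\<Sum>k\<in>{0..r}. schur_F r k)"
    by (rule sum.reindex_bij_witness[where i = "\<lambda>k. r - k" and j = "\<lambda>k. r - k"]) auto
  finally show ?thesis .
qed

lemma paired_total_reflect: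
  assumes "-3 \<le> p" "p \<le> r"
  shows "paired_total r (r - 3 - p) = paired_total r p"
proof -
  define s where "s = r - 3 - p"
  have s: "r - s = p + 3" "r - (s + 1) = p + 2" "r - (s + 2) = p + 1" "r - (s + 3) = p"
    "s + 1 = r - (p + 2)" "s + 2 = r - (p + 1)" "s + 3 = r - p" "s = r - (p + 3)"
    by (simp_all add: s_def)
  have "paired_total r s = products_0 s (r - s) + products_1 (s + 1) (r - (s + 1))
    + products_1 (r - (s + 2)) (s + 2) + products_0 (r - (s + 3)) (s + 3)"
    using assms by (intro paired_total_eq) (simp add: s_def)
  also have "\<dots> = products_0 (r - (p + 3)) (p + 3) + products_1 (r - (p + 2)) (p + 2)
    + products_1 (p + 1) (r - (p + 1)) + products_0 p (r - p)"
    unfolding s(1-4) unfolding s(5-7) by (simp only: s(8))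
  also have "\<dots> = paired_total r p"
    using assms by (simp add: paired_total_eq add_ac)
  finally show ?thesis
    by (simp only: s_def)
qed

text \<open>
  For \<open>q = r - 1 - p\<close> equal to \<open>p + 1\<close>, \<open>p + 2\<close> or \<open>p + 3\<close>, one of the two rows for \<open>q\<close> coincides
  with one of the two rows for \<open>p\<close>.
\<close>

lemma paired_total_middle:
  assumes "2 * p \<in> {r - 4..r - 2}"
  shows "paired_total r p = 0"
proof -
  have "jt elementary 6 ((!) [a, p, p, r - 1 - p, r - 1 - p, r - m - a]) = 0" for a m
  proof -
    consider "2 * p = r - 2" | "2 * p = r - 3" | "2 * p = r - 4"
      using assms by force
    then show ?thesis
    proof cases
      \<comment> \<open>The rows of the determinant start at the indices \<open>a\<close>, \<open>p - 1\<close>, \<open>p - 2\<close>, \<open>q - 3\<close>, \<open>q - 4\<close> and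
        \<open>r - m - a - 5\<close> with \<open>q = r - 1 - p\<close>.\<close>
      case 1
      then show ?thesis
        by (intro jt_equal_rows[of 2 _ 3]) auto
    next
      case 2
      then show ?thesis
        by (intro jt_equal_rows[of 1 _ 3]) auto
    next
      case 3
      then show ?thesis
        by (intro jt_equal_rows[of 1 _ 4]) auto
    qed
  qed
  then have "paired_sum r p m = 0" for m
    by (simp add: paired_sum_def)
  then show ?thesis
    by (simp add: paired_total_def)
qed

lemma schur_positive_paired_total:
  assumes "r - 1 \<le> 2 * p"
  shows "schur_positive (paired_total r p)"
proof -
  have "schur_positive (paired_sum r p m)" if "0 \<le> m" for m
    unfolding paired_sum_def
  proof (rule schur_positive_sum)
    fix a
    assume "a \<in> {p..r}"
    with assms that have "jt elementary (Suc 5) ((!) [a, p, p, r - 1 - p, r - 1 - p, r - m - a]) = 0 \<or>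
        (\<exists>\<mu>. is_partition \<mu> \<and> jt elementary (Suc 5) ((!) [a, p, p, r - 1 - p, r - 1 - p, r - m - a]) = schur \<mu>)"
      by (intro jt_eq_0_or_schur) (auto simp: less_Suc_eq numeral_eq_Suc)
    then show "schur_positive (jt elementary 6 ((!) [a, p, p, r - 1 - p, r - 1 - p, r - m - a]))"
      using schur_positive_0 schur_positive_schur by force
  qed
  then show ?thesis
    unfolding paired_total_def mult_2 by (intro schur_positive_add) auto
qed

theorem theorem5p2:
  fixes r :: int
  assumes "r \<ge> 1"
  shows "schur_positive (\<Sum>k\<in>{0..r}. schur_F r k)"
proof -
  let ?I = "{p. p \<le> r \<and> r - 1 \<le> 2 * p}" and ?J = "{p. -3 \<le> p \<and> 2 * p \<le> r - 5}"
  have fin: "finite ?I" "finite ?J"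
    using assms by (auto intro: finite_subset[of _ "{-3..r}"])
  \<comment> \<open>The reflection \<open>p \<mapsto> r - 3 - p\<close> of \<open>{-3..r}\<close> exchanges \<open>?I\<close> and \<open>?J\<close>; the at most two
    values outside both contribute 0.\<close>
  have "(\<Sum>p\<in>{-3..r}. paired_total r p) = (\<Sum>p\<in>?I \<union> ?J. paired_total r p)"
    using assms by (intro sum.mono_neutral_right) (auto intro!: paired_total_middle)
  also have "\<dots> = (\<Sum>p\<in>?I. paired_total r p) + (\<Sum>p\<in>?J. paired_total r p)"
    using fin by (intro sum.union_disjoint) auto
  also have "(\<Sum>p\<in>?J. paired_total r p) = (\<Sum>p\<in>?I. paired_total r p)"
    using assms
    by (intro sum.reindex_bij_witness[where i = "\<lambda>p. r - 3 - p" and j = "\<lambda>p. r - 3 - p"])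
       (auto intro!: paired_total_reflect)
  finally have "(\<Sum>k\<in>{0..r}. schur_F r k) = (\<Sum>p\<in>?I. paired_total r p)"
    unfolding sum_paired_total by (rule mfps_double_cancel)
  then show ?thesis
    by (auto intro!: schur_positive_sum schur_positive_paired_total)
qed

end
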